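(* Let $\{(x^i,y_i)\}_{i=1}^n\subset\mathbb{R}^d_+\times[K]$, $p_w,p_v,p_u\in(1,\infty)$, $\rho_w,\rho_v,\rho_u>0$, $\epsilon>0$, $n_1,n_2\in\mathbb{N}$, $\alpha\in\mathbb{R}^{n_1}$, $\beta\in\mathbb{R}^{n_2}$ with $\alpha_i\ge1$, $\beta_j\ge1$ for all $i,j$. Let $\rho_x=\max_{i\in[n]}\|x^i\|_{p_u'}$, $$\theta=\rho_v\Psi^\alpha_{p_v',p_u}(\mathbf{1},\rho_u\rho_x),\quad C_w=\rho_w\Psi^\beta_{p_w',p_v}(\mathbf{1},\theta),\quad C_v=\rho_w\Psi^\beta_{p_w',p_v}(\beta,\theta),\quad C_u=\|\alpha\|_\infty C_v,$$ and define $A\in\mathbb{R}^{(K+2)\times(K+2)}_{++}$ for $m,l\in[K]$ by $A_{m,l}=4(p_w'-1)C_w$, $A_{m,K+1}=2(p_w'-1)(2C_v+\|\beta\|_\infty)$, $A_{m,K+2}=2(p_w'-1)(2C_u+\|\alpha\|_\infty\|\beta\|_\infty)$, $A_{K+1,l}=2(p_v'-1)(2C_w+1)$, $A_{K+1,K+1}=2(p_v'-1)(2C_v+\|\beta\|_\infty-1)$, $A_{K+1,K+2}=2(p_v'-1)(2C_u+\|\alpha\|_\infty\|\beta\|_\infty)$, $A_{K+2,l}=2(p_u'-1)(2C_w+1)$, $A_{K+2,K+1}=2(p_u'-1)(2C_v+\|\beta\|_\infty)$, $A_{K+2,K+2}=2(p_u'-1)(2C_u+\|\alpha\|_\infty\|\beta\|_\infty-1)$.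 If $\rho(A)<1$, then $\max_{(w,v,u)\in S_+}\Phi(w,v,u)$ has a unique global maximizer $(w^*,v^*,u^* )$, which lies in $S_{++}$. Moreover, for every $(w^0,v^0,u^0)\in S_{++}$, the sequence $(w^{k+1},v^{k+1},u^{k+1})=G^\Phi(w^k,v^k,u^k)$ converges to $(w^*,v^*,u^* )$, and there exists $R>0$ with $\|(w^k,v^k,u^k)-(w^*,v^*,u^* )\|_\infty\le R\,\rho(A)^k$ for all $k\in\mathbb{N}$.
   Context: Notation: $\mathbb{R}_+=[0,\infty)$, $\mathbb{R}_{++}=(0,\infty)$, $[m]=\{1,\dots,m\}$; entrywise $\ell_p$ norms for matrices; $p'=p/(p-1)$; $\psi_p(z)=\operatorname{sign}(z)|z|^{p-1}$ componentwise; $\rho(A)$ spectral radius; $\mathbf{1}$ all-ones vector of appropriate size. Two-hidden-layer network with parameters $w\in\mathbb{R}^{K\times n_2}_+$ (rows $w_1,\dots,w_K$), $v\in\mathbb{R}^{n_2\times n_1}_+$, $u\in\mathbb{R}^{n_1\times d}_+$: $$f_r(w,v,u)(x)=\sum_{l=1}^{n_2}w_{r,l}\Big(\sum_{m=1}^{n_1}v_{lm}\Big(\sum_{s=1}^d u_{ms}x_s\Big)^{\alpha_m}\Big)^{\beta_l}.$$ Loss $L(y,f(x))=-f_y(x)+\log\sum_{j=1}^K e^{f_j(x)}$. Objective $$\Phi(w,v,u)=\frac1n\sum_{i=1}^n\Big[-L(y_i,f(x^i))+\sum_{r=1}^K f_r(x^i)\Big]+\epsilon\Big(\sum_{r,l}w_{r,l}+\sum_{l,m}v_{lm}+\sum_{m,s}u_{ms}\Big).$$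 $S_+=\{(w,v,u)\in\mathbb{R}^{K\times n_2}_+\times\mathbb{R}^{n_2\times n_1}_+\times\mathbb{R}^{n_1\times d}_+ : \|w_i\|_{p_w}=\rho_w\ \forall i\in[K],\ \|v\|_{p_v}=\rho_v,\ \|u\|_{p_u}=\rho_u\}$; $S_{++}$ the subset with all entries strictly positive. $G^\Phi=(G^\Phi_{w_1},\dots,G^\Phi_{w_K},G^\Phi_v,G^\Phi_u)$ with $G^\Phi_{w_i}=\rho_w\psi_{p_w'}(\nabla_{w_i}\Phi)/\|\psi_{p_w'}(\nabla_{w_i}\Phi)\|_{p_w}$, $G^\Phi_v=\rho_v\psi_{p_v'}(\nabla_v\Phi)/\|\psi_{p_v'}(\nabla_v\Phi)\|_{p_v}$, $G^\Phi_u=\rho_u\psi_{p_u'}(\nabla_u\Phi)/\|\psi_{p_u'}(\nabla_u\Phi)\|_{p_u}$. For $p,q\ge1$ and $\gamma\in\mathbb{R}^r_{++}$, $\Psi^\gamma_{p,q}(\delta,t)=\big([\sum_{l\in J}(\delta_lt^{\gamma_l})^{pq/(q-\bar\gamma p)}]^{1-\bar\gamma p/q}+\max_{j\in J^c}(\delta_jt^{\gamma_j})^p\big)^{1/p}$ for $\delta\in\mathbb{R}^r_{++}$, $t>0$, where $J=\{l:\gamma_lp<q\}$, $J^c=\{l:\gamma_lp\ge q\}$, $\bar\gamma=\min_{l\in J}\gamma_l$, empty sums/maxima $=0$. *)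

theory Defs
  imports "HOL-Analysis.Analysis" "Jordan_Normal_Form.Spectral_Radius"
begin

text \<open>Conventions: all indices are 0-based; a vector of length m is a function
  nat => real on {..<m}, an a x b matrix is a function nat => nat => real on
  {..<a} x {..<b}. Network parameters are triples (w,v,u) and are required to
  vanish outside their index ranges.\<close>

type_synonym params = "(nat \<Rightarrow> nat \<Rightarrow> real) \<times> (nat \<Rightarrow> nat \<Rightarrow> real) \<times> (nat \<Rightarrow> nat \<Rightarrow> real)"

definition conj_exp :: "real \<Rightarrow> real" where
  "conj_exp p = p / (p - 1)"

definition pnorm :: "real \<Rightarrow> 'i set \<Rightarrow> ('i \<Rightarrow> real) \<Rightarrow> real" where
  "pnorm p I f = (\<Sum>j\<in>I. \<bar>f j\<bar> powr p) powr (1 / p)"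

definition mnorm :: "real \<Rightarrow> nat \<Rightarrow> nat \<Rightarrow> (nat \<Rightarrow> nat \<Rightarrow> real) \<Rightarrow> real" where
  "mnorm p a b M = pnorm p ({..<a} \<times> {..<b}) (\<lambda>(i, j). M i j)"

definition supnorm_vec :: "nat \<Rightarrow> (nat \<Rightarrow> real) \<Rightarrow> real" where
  "supnorm_vec m a = Max ((\<lambda>i. \<bar>a i\<bar>) ` {..<m})"

definition psi :: "real \<Rightarrow> real \<Rightarrow> real" where
  "psi p z = sgn z * \<bar>z\<bar> powr (p - 1)"

definition PsiFun :: "nat \<Rightarrow> (nat \<Rightarrow> real) \<Rightarrow> real \<Rightarrow> real \<Rightarrow> (nat \<Rightarrow> real) \<Rightarrow> real \<Rightarrow> real" where
  "PsiFun r \<gamma> p q \<delta> t =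
    (let J = {l \<in> {..<r}. \<gamma> l * p < q};
         Jc = {l \<in> {..<r}. \<gamma> l * p \<ge> q};
         gb = Min (\<gamma> ` J)
     in ((\<Sum>l\<in>J. (\<delta> l * t powr \<gamma> l) powr (p * q / (q - gb * p))) powr (1 - gb * p / q)
         + (if Jc = {} then 0 else Max ((\<lambda>j. (\<delta> j * t powr \<gamma> j) powr p) ` Jc))) powr (1 / p))"

definition net_f :: "nat \<Rightarrow> nat \<Rightarrow> nat \<Rightarrow> (nat \<Rightarrow> real) \<Rightarrow> (nat \<Rightarrow> real) \<Rightarrow> params
    \<Rightarrow> (nat \<Rightarrow> real) \<Rightarrow> nat \<Rightarrow> real" where
  "net_f n2 n1 d \<alpha> \<beta> P x r =
    (case P of (w, v, u) \<Rightarrow>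
      (\<Sum>l<n2. w r l * (\<Sum>m<n1. v l m * (\<Sum>s<d. u m s * x s) powr \<alpha> m) powr \<beta> l))"

definition ce_loss :: "nat \<Rightarrow> nat \<Rightarrow> (nat \<Rightarrow> real) \<Rightarrow> real" where
  "ce_loss K y f = - f y + ln (\<Sum>j<K. exp (f j))"

definition Phi :: "nat \<Rightarrow> nat \<Rightarrow> nat \<Rightarrow> nat \<Rightarrow> nat \<Rightarrow> (nat \<Rightarrow> real) \<Rightarrow> (nat \<Rightarrow> real) \<Rightarrow> real
    \<Rightarrow> (nat \<Rightarrow> nat \<Rightarrow> real) \<Rightarrow> (nat \<Rightarrow> nat) \<Rightarrow> params \<Rightarrow> real" where
  "Phi n K n2 n1 d \<alpha> \<beta> \<epsilon> X Y P =
    (case P of (w, v, u) \<Rightarrow>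
      (1 / real n) * (\<Sum>i<n. - ce_loss K (Y i) (net_f n2 n1 d \<alpha> \<beta> P (X i))
                          + (\<Sum>r<K. net_f n2 n1 d \<alpha> \<beta> P (X i) r))
      + \<epsilon> * ((\<Sum>r<K. \<Sum>l<n2. w r l) + (\<Sum>l<n2. \<Sum>m<n1. v l m) + (\<Sum>m<n1. \<Sum>s<d. u m s)))"

definition supported :: "nat \<Rightarrow> nat \<Rightarrow> (nat \<Rightarrow> nat \<Rightarrow> real) \<Rightarrow> bool" where
  "supported a b M \<longleftrightarrow> (\<forall>i j. \<not> (i < a \<and> j < b) \<longrightarrow> M i j = 0)"

definition S_plus :: "nat \<Rightarrow> nat \<Rightarrow> nat \<Rightarrow> nat \<Rightarrow> real \<Rightarrow> real \<Rightarrow> real \<Rightarrow> real \<Rightarrow> real \<Rightarrow> real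
    \<Rightarrow> params set" where
  "S_plus K n2 n1 d pw pv pu \<rho>w \<rho>v \<rho>u =
    {(w, v, u). supported K n2 w \<and> supported n2 n1 v \<and> supported n1 d u
       \<and> (\<forall>i j. w i j \<ge> 0) \<and> (\<forall>i j. v i j \<ge> 0) \<and> (\<forall>i j. u i j \<ge> 0)
       \<and> (\<forall>i<K. pnorm pw {..<n2} (w i) = \<rho>w)
       \<and> mnorm pv n2 n1 v = \<rho>v \<and> mnorm pu n1 d u = \<rho>u}"

definition S_pp :: "nat \<Rightarrow> nat \<Rightarrow> nat \<Rightarrow> nat \<Rightarrow> real \<Rightarrow> real \<Rightarrow> real \<Rightarrow> real \<Rightarrow> real \<Rightarrow> real
    \<Rightarrow> params set" where
  "S_pp K n2 n1 d pw pv pu \<rho>w \<rho>v \<rho>u =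
    {(w, v, u) \<in> S_plus K n2 n1 d pw pv pu \<rho>w \<rho>v \<rho>u.
       (\<forall>i<K. \<forall>j<n2. w i j > 0) \<and> (\<forall>i<n2. \<forall>j<n1. v i j > 0) \<and> (\<forall>i<n1. \<forall>j<d. u i j > 0)}"

definition grad_w :: "(params \<Rightarrow> real) \<Rightarrow> params \<Rightarrow> nat \<Rightarrow> nat \<Rightarrow> real" where
  "grad_w F P i j = (case P of (w, v, u) \<Rightarrow> deriv (\<lambda>t. F (w(i := (w i)(j := t)), v, u)) (w i j))"

definition grad_v :: "(params \<Rightarrow> real) \<Rightarrow> params \<Rightarrow> nat \<Rightarrow> nat \<Rightarrow> real" where
  "grad_v F P i j = (case P of (w, v, u) \<Rightarrow> deriv (\<lambda>t. F (w, v(i := (v i)(j := t)), u)) (v i j))"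

definition grad_u :: "(params \<Rightarrow> real) \<Rightarrow> params \<Rightarrow> nat \<Rightarrow> nat \<Rightarrow> real" where
  "grad_u F P i j = (case P of (w, v, u) \<Rightarrow> deriv (\<lambda>t. F (w, v, u(i := (u i)(j := t)))) (u i j))"

definition G_map :: "nat \<Rightarrow> nat \<Rightarrow> nat \<Rightarrow> nat \<Rightarrow> real \<Rightarrow> real \<Rightarrow> real \<Rightarrow> real \<Rightarrow> real \<Rightarrow> real
    \<Rightarrow> (params \<Rightarrow> real) \<Rightarrow> params \<Rightarrow> params" where
  "G_map K n2 n1 d pw pv pu \<rho>w \<rho>v \<rho>u F P =
    (let gw = (\<lambda>i j. psi (conj_exp pw) (grad_w F P i j));
         gv = (\<lambda>i j. psi (conj_exp pv) (grad_v F P i j));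
         gu = (\<lambda>i j. psi (conj_exp pu) (grad_u F P i j))
     in ((\<lambda>i j. if i < K \<and> j < n2 then \<rho>w * gw i j / pnorm pw {..<n2} (gw i) else 0),
         (\<lambda>i j. if i < n2 \<and> j < n1 then \<rho>v * gv i j / mnorm pv n2 n1 gv else 0),
         (\<lambda>i j. if i < n1 \<and> j < d then \<rho>u * gu i j / mnorm pu n1 d gu else 0)))"

definition dist_inf :: "nat \<Rightarrow> nat \<Rightarrow> nat \<Rightarrow> nat \<Rightarrow> params \<Rightarrow> params \<Rightarrow> real" where
  "dist_inf K n2 n1 d P Q =
    (case P of (w, v, u) \<Rightarrow> case Q of (w', v', u') \<Rightarrow>
      Max ((\<lambda>(i, j). \<bar>w i j - w' i j\<bar>) ` ({..<K} \<times> {..<n2})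
         \<union> (\<lambda>(i, j). \<bar>v i j - v' i j\<bar>) ` ({..<n2} \<times> {..<n1})
         \<union> (\<lambda>(i, j). \<bar>u i j - u' i j\<bar>) ` ({..<n1} \<times> {..<d})))"

text \<open>The matrix A (0-based: rows/cols 0..K-1 are [K], K is K+1, K+1 is K+2).\<close>
definition A_entry :: "nat \<Rightarrow> real \<Rightarrow> real \<Rightarrow> real \<Rightarrow> real \<Rightarrow> real \<Rightarrow> real \<Rightarrow> real \<Rightarrow> real
    \<Rightarrow> nat \<Rightarrow> nat \<Rightarrow> real" where
  "A_entry K pw pv pu Cw Cv Cu na nb m l =
    (let qw = conj_exp pw; qv = conj_exp pv; qu = conj_exp pu in
     if m < K then
       (if l < K then 4 * (qw - 1) * Cw
        else if l = K then 2 * (qw - 1) * (2 * Cv + nb)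
        else 2 * (qw - 1) * (2 * Cu + na * nb))
     else if m = K then
       (if l < K then 2 * (qv - 1) * (2 * Cw + 1)
        else if l = K then 2 * (qv - 1) * (2 * Cv + nb - 1)
        else 2 * (qv - 1) * (2 * Cu + na * nb))
     else
       (if l < K then 2 * (qu - 1) * (2 * Cw + 1)
        else if l = K then 2 * (qu - 1) * (2 * Cv + nb)
        else 2 * (qu - 1) * (2 * Cu + na * nb - 1)))"

definition A_mat :: "nat \<Rightarrow> real \<Rightarrow> real \<Rightarrow> real \<Rightarrow> real \<Rightarrow> real \<Rightarrow> real \<Rightarrow> real \<Rightarrow> real
    \<Rightarrow> complex mat" where
  "A_mat K pw pv pu Cw Cv Cu na nb =
    mat (K + 2) (K + 2) (\<lambda>(m, l). complex_of_real (A_entry K pw pv pu Cw Cv Cu na nb m l))"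

end

theory Submission
  imports Defs
begin

text \<open>
  Measure the distance of two positive parameters blockwise by the sup norm of the difference of
  their logarithms. Scaling the entries of the blocks by at most \<open>exp \<mu>w\<close>, \<open>exp \<mu>v\<close>, \<open>exp \<mu>u\<close> scales
  every term of the network and of its gradient by a controlled factor, and changes the outputs
  additively by at most \<open>Cw * \<mu>w + Cv * \<mu>v + Cu * \<mu>u\<close> because \<open>1 - exp (-L) \<le> L\<close> holds termwise; the derivatives
  of the loss with respect to the outputs are ratios of sums of exponentials and so change by the
  exponential of twice that amount. Hence \<open>G\<close> contracts the vector of blockwise distances by \<open>A\<close>,
  with no second derivatives involved. A positive vector \<open>b\<close> with \<open>A b = \<lambda> b\<close> can be written down
  explicitly, so \<open>G\<close> contracts the \<open>b\<close>-weighted metric by \<open>\<lambda> \<le> \<rho>(A) < 1\<close>. A maximizer exists by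
  compactness; it is positive, since raising a zero entry gains linearly while restoring the norm
  costs only a power \<open>p > 1\<close>, and by the Lagrange condition it is a fixed point of \<open>G\<close>.
\<close>

section \<open>Ascent on a product of spheres\<close>

text \<open>The entries of A count the places where a logarithmic change enters \<open>G\<close>.
  The leading 2 appears because a power of a gradient entry is divided by the norm of its own block,
  and both vary; \<open>conj_exp p - 1\<close> is the power applied by \<open>psi\<close>. The terms
  \<open>2 * Cw\<close>, \<open>2 * Cv\<close>, \<open>2 * Cu\<close> come from the loss: each
  derivative weight is a quotient of sums of exponentials of the outputs, and again both parts vary.
  The remaining summands bound the degrees of homogeneity of a gradient entry in w, v and u: a
  derivative in v or u lowers the degree in that variable by one, and a derivative in w removes w.
  Relative bounds do not survive cancellation, so all terms must be nonnegative; adding the outputs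
  to the negative loss in \<open>Phi\<close> makes the derivative weights nonnegative, and
  \<epsilon> makes the gradient strictly positive even where the network vanishes.\<close>

lemma pnorm_nonneg [simp]: "pnorm p A f \<ge> 0"
  by (simp add: pnorm_def)

lemma pnorm_eq_iff:
  assumes "p > 0" "r \<ge> 0"
  shows "pnorm p A f = r \<longleftrightarrow> (\<Sum>j\<in>A. \<bar>f j\<bar> powr p) = r powr p"
proof
  assume "pnorm p A f = r"
  then show "(\<Sum>j\<in>A. \<bar>f j\<bar> powr p) = r powr p"
    using assms by (auto simp: pnorm_def powr_powr sum_nonneg)
next
  assume "(\<Sum>j\<in>A. \<bar>f j\<bar> powr p) = r powr p"
  then show "pnorm p A f = r" using assms by (simp add: pnorm_def powr_powr)
qed

lemma pnorm_scale:
  assumes "p > 0" "c \<ge> 0"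
  shows "pnorm p A (\<lambda>j. c * f j) = c * pnorm p A f"
  using assms
  by (simp add: pnorm_def abs_mult powr_mult sum_distrib_left[symmetric] powr_powr sum_nonneg)

lemma pnorm_mono:
  assumes "p > 0" "\<And>j. j \<in> A \<Longrightarrow> \<bar>f j\<bar> \<le> \<bar>h j\<bar>"
  shows "pnorm p A f \<le> pnorm p A h"
  unfolding pnorm_def using assms by (intro powr_mono2 sum_mono sum_nonneg) auto

lemma pnorm_cong:
  assumes "\<And>j. j \<in> A \<Longrightarrow> f j = h j"
  shows "pnorm p A f = pnorm p A h"
  unfolding pnorm_def using assms by simp

lemma abs_le_pnorm:
  assumes "finite A" "j \<in> A" "p > 0"
  shows "\<bar>f j\<bar> \<le> pnorm p A f"
proof -
  have "\<bar>f j\<bar> = (\<bar>f j\<bar> powr p) powr (1 / p)" using assms by (simp add: powr_powr)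
  also have "\<dots> \<le> pnorm p A f"
    unfolding pnorm_def using assms
    by (intro powr_mono2 member_le_sum[of j A "\<lambda>j. \<bar>f j\<bar> powr p"]) auto
  finally show ?thesis .
qed

lemma conj_exp_minus_1:
  assumes "p > 1"
  shows "conj_exp p - 1 = 1 / (p - 1)"
  using assms by (simp add: conj_exp_def field_simps)

text \<open>On \<open>(0, r]\<close> the logarithm has slope at least \<open>1 / r\<close>. This is
  the way back from the logarithmic metric to the sup norm.\<close>

lemma abs_diff_le_ln_diff:
  fixes x y r :: real
  assumes "0 < x" "0 < y" "x \<le> r" "y \<le> r"
  shows "\<bar>x - y\<bar> \<le> r * \<bar>ln x - ln y\<bar>"
proof -
  have *: "b - a \<le> r * (ln b - ln a)" if "0 < a" "a \<le> b" "b \<le> r" for a b :: real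
  proof -
    have "ln a - ln b \<le> a / b - 1" using ln_le_minus_one[of "a / b"] that by (simp add: ln_div)
    then have "b - a \<le> b * (ln b - ln a)" using that by (simp add: field_simps)
    also have "\<dots> \<le> r * (ln b - ln a)" using that by (intro mult_right_mono) auto
    finally show ?thesis .
  qed
  show ?thesis using *[of x y] *[of y x] assms by (cases "x \<le> y") (auto simp: abs_if)
qed

text \<open>All parameters form one nonnegative function on an index set, and \<open>blk\<close>
  tells to which sphere an index belongs, so the rows of w and the matrices v and u are treated
  alike. \<open>b\<close> holds the weights of the metric.\<close>

locale multi_sphere =
  fixes I :: "'i set" and blk :: "'i \<Rightarrow> 'k" and p \<rho> b :: "'k \<Rightarrow> real"
  assumes finite_I: "finite I"
    and p_gt_1: "\<And>k. 1 < p k" and rho_pos: "\<And>k. 0 < \<rho> k" and b_pos: "\<And>k. 0 < b k"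
begin

definition B :: "'k \<Rightarrow> 'i set" where
  "B k = {i \<in> I. blk i = k}"

text \<open>The value 0 off \<open>I\<close> makes equality of functions the right notion of
  uniqueness and allows compactness. Only inhabited blocks carry a norm condition, since an empty
  block has norm 0 and not \<open>\<rho> k\<close>.\<close>

definition S :: "('i \<Rightarrow> real) set" where
  "S = {z. (\<forall>i. 0 \<le> z i) \<and> (\<forall>i. i \<notin> I \<longrightarrow> z i = 0)
         \<and> (\<forall>k \<in> blk ` I. pnorm (p k) (B k) z = \<rho> k)}"

definition Spos :: "('i \<Rightarrow> real) set" where
  "Spos = {z \<in> S. \<forall>i\<in>I. 0 < z i}"

text \<open>\<open>M\<close> bounds the \<open>b\<close>-weighted Thompson distance. A predicate
  with an explicit bound avoids suprema, in particular over an empty index set.\<close>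

definition close :: "real \<Rightarrow> ('i \<Rightarrow> real) \<Rightarrow> ('i \<Rightarrow> real) \<Rightarrow> bool" where
  "close M z z' \<longleftrightarrow> (\<forall>i\<in>I. \<bar>ln (z i) - ln (z' i)\<bar> \<le> M * b (blk i))"

lemma finite_B: "finite (B k)"
  using finite_I by (simp add: B_def)

lemma in_B: "i \<in> I \<Longrightarrow> i \<in> B (blk i)"
  by (simp add: B_def)

lemma S_le_rho:
  assumes "z \<in> S" "i \<in> I"
  shows "z i \<le> \<rho> (blk i)"
proof -
  have "0 < p (blk i)" using p_gt_1[of "blk i"] by simp
  then show ?thesis using abs_le_pnorm[OF finite_B in_B, of i "p (blk i)" z] assms by (auto simp: S_def)
qed

lemma S_nonempty: "S \<noteq> {}"
proof -
  define z where "z i = (if i \<in> I then \<rho> (blk i) / real (card (B (blk i))) powr (1 / p (blk i)) else 0)" for i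
  have "pnorm (p k) (B k) z = \<rho> k" if "k \<in> blk ` I" for k
  proof -
    have pk: "0 < p k" and rk: "0 < \<rho> k" using p_gt_1[of k] rho_pos[of k] by auto
    have card: "0 < card (B k)" using that finite_B[of k] by (auto simp: card_gt_0_iff B_def)
    have "(\<Sum>j\<in>B k. \<bar>z j\<bar> powr p k) = (\<Sum>j\<in>B k. \<rho> k powr p k / card (B k))"
    proof (intro sum.cong refl)
      fix j assume "j \<in> B k"
      then have "z j = \<rho> k / real (card (B k)) powr (1 / p k)" by (simp add: z_def B_def)
      then show "\<bar>z j\<bar> powr p k = \<rho> k powr p k / card (B k)"
        using card pk rk by (simp add: powr_divide powr_powr)
    qed
    also have "\<dots> = \<rho> k powr p k" using card by simp
    finally show ?thesis using pk rk by (simp add: pnorm_eq_iff)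
  qed
  moreover have "0 \<le> z i" for i using rho_pos[of "blk i"] by (simp add: z_def)
  ultimately have "z \<in> S" by (auto simp: S_def z_def)
  then show ?thesis by auto
qed

text \<open>Tychonoff: a product of compact intervals, with the factor \<open>{0}\<close> off
  \<open>I\<close>, is compact in the product topology, and a block norm is continuous there because
  it reads finitely many coordinates.\<close>

lemma compact_S: "compact S"
proof -
  define box where "box = Pi\<^sub>E UNIV (\<lambda>i. if i \<in> I then {0..\<rho> (blk i)} else {0::real})"
  have "compactin (product_topology (\<lambda>i. euclidean) UNIV) box"
    unfolding box_def compactin_PiE by auto
  then have "compact box" by (simp add: euclidean_product_topology)
  have cont: "continuous_on UNIV (\<lambda>z. pnorm (p k) (B k) z)" for k
  proof -
    have "continuous_on UNIV (\<lambda>z::'i \<Rightarrow> real. (\<Sum>j\<in>B k. \<bar>z j\<bar> powr p k) powr (1 / p k))"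
      using p_gt_1[of k]
      by (intro continuous_on_powr' continuous_on_sum continuous_intros continuous_on_product_coordinates)
         (auto intro!: sum_nonneg)
    then show ?thesis by (simp add: pnorm_def)
  qed
  have "closed (\<Inter>k\<in>blk ` I. {z. pnorm (p k) (B k) z = \<rho> k})"
    by (intro closed_INT ballI closed_Collect_eq cont continuous_on_const)
  moreover have "S = box \<inter> (\<Inter>k\<in>blk ` I. {z. pnorm (p k) (B k) z = \<rho> k})"
  proof (intro equalityI subsetI)
    fix z assume "z \<in> S"
    then show "z \<in> box \<inter> (\<Inter>k\<in>blk ` I. {z. pnorm (p k) (B k) z = \<rho> k})"
      using S_le_rho by (auto simp: box_def S_def)
  next
    fix z assume z: "z \<in> box \<inter> (\<Inter>k\<in>blk ` I. {z. pnorm (p k) (B k) z = \<rho> k})"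
    then have "z i \<in> (if i \<in> I then {0..\<rho> (blk i)} else {0})" for i
      by (auto simp: box_def PiE_def Pi_def)
    then have "0 \<le> z i \<and> (i \<notin> I \<longrightarrow> z i = 0)" for i
      by (metis atLeastAtMost_iff order.refl singletonD)
    with z show "z \<in> S" by (auto simp: S_def)
  qed
  ultimately show ?thesis using \<open>compact box\<close> by (simp add: compact_Int_closed)
qed

text \<open>The admissible moves: two entries of a block trade mass while the sum of their p-th
  powers is kept. Positivity and stationarity of maximizers are both tested with such moves.\<close>

lemma S_exchange:
  assumes "z \<in> S" "j \<in> I" "m \<in> I" "blk m = blk j" "j \<noteq> m" "0 \<le> x" "0 \<le> y"
    and "x powr p (blk j) + y powr p (blk j) = z j powr p (blk j) + z m powr p (blk j)"
  shows "z(j := x, m := y) \<in> S"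
proof -
  let ?z = "z(j := x, m := y)"
  have zn: "0 \<le> z i" for i using assms(1) by (simp add: S_def)
  have pk: "0 < p k" and rk: "0 < \<rho> k" for k using p_gt_1[of k] rho_pos[of k] by auto
  have "pnorm (p k) (B k) ?z = \<rho> k" if k: "k \<in> blk ` I" for k
  proof (cases "k = blk j")
    case True
    have jm: "j \<in> B k" "m \<in> B k - {j}" using assms True by (auto simp: B_def)
    have split: "(\<Sum>i\<in>B k. f i) = f j + (f m + (\<Sum>i\<in>B k - {j} - {m}. f i))" for f :: "'i \<Rightarrow> real"
      using jm finite_B[of k] by (simp add: sum.remove[of _ j] sum.remove[of _ m])
    have "(\<Sum>i\<in>B k - {j} - {m}. \<bar>?z i\<bar> powr p k) = (\<Sum>i\<in>B k - {j} - {m}. \<bar>z i\<bar> powr p k)"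
      by (intro sum.cong) auto
    then have "(\<Sum>i\<in>B k. \<bar>?z i\<bar> powr p k) = (\<Sum>i\<in>B k. \<bar>z i\<bar> powr p k)"
      unfolding split using assms zn[of j] zn[of m] True by simp
    moreover have "pnorm (p k) (B k) z = \<rho> k" using assms(1) k by (auto simp: S_def)
    ultimately show ?thesis by (simp add: pnorm_def)
  next
    case False
    then have "pnorm (p k) (B k) ?z = pnorm (p k) (B k) z"
      using assms by (intro pnorm_cong) (auto simp: B_def)
    then show ?thesis using assms(1) k by (auto simp: S_def)
  qed
  then show ?thesis using assms zn by (auto simp: S_def)
qed

end

text \<open>The interface that a network has to meet. \<open>deriv_F\<close> differentiates along
  curves, and only at positive points; on the boundary the one-sided estimates \<open>gain_F\<close>
  and \<open>loss_F\<close> take its place. \<open>loss_F\<close> scales a coordinate instead of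
  shifting it because the network estimates are relative.\<close>

locale ascent = multi_sphere I blk p \<rho> b
  for I :: "'i set" and blk :: "'i \<Rightarrow> 'k" and p \<rho> b :: "'k \<Rightarrow> real" +
  fixes F :: "('i \<Rightarrow> real) \<Rightarrow> real" and g :: "('i \<Rightarrow> real) \<Rightarrow> 'i \<Rightarrow> real" and \<epsilon> lam :: real
  assumes eps_pos: "0 < \<epsilon>" and lam: "0 \<le> lam" "lam < 1"
    and cont_F: "continuous_on {z. \<forall>i. 0 \<le> z i} F"
    and deriv_F: "\<And>c c' t. \<forall>i\<in>I. 0 < c t i \<Longrightarrow>
           \<forall>i\<in>I. ((\<lambda>s. c s i) has_real_derivative c' i) (at t) \<Longrightarrow>
           ((\<lambda>s. F (c s)) has_real_derivative (\<Sum>i\<in>I. g (c t) i * c' i)) (at t)"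
    and gain_F: "\<And>z j t. \<forall>i. 0 \<le> z i \<Longrightarrow> j \<in> I \<Longrightarrow> 0 \<le> t \<Longrightarrow> F z + \<epsilon> * t \<le> F (z(j := z j + t))"
    and loss_F: "\<And>z j. z \<in> S \<Longrightarrow> j \<in> I \<Longrightarrow> \<exists>C. \<forall>s\<in>{1/2..1}. F z - F (z(j := s * z j)) \<le> C * (1 - s)"
    and g_pos: "\<And>z i. z \<in> Spos \<Longrightarrow> i \<in> I \<Longrightarrow> 0 < g z i"
    and g_lip: "\<And>z z' M i. z \<in> Spos \<Longrightarrow> z' \<in> Spos \<Longrightarrow> 0 \<le> M \<Longrightarrow> close M z z' \<Longrightarrow> i \<in> I \<Longrightarrow>
           2 * (conj_exp (p (blk i)) - 1) * (ln (g z i) - ln (g z' i)) \<le> lam * M * b (blk i)"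
begin

section \<open>Contraction of the normalized gradient step\<close>

definition step :: "('i \<Rightarrow> real) \<Rightarrow> 'i \<Rightarrow> real" where
  "step z i = (if i \<in> I
     then \<rho> (blk i) * psi (conj_exp (p (blk i))) (g z i)
          / pnorm (p (blk i)) (B (blk i)) (\<lambda>j. psi (conj_exp (p (blk i))) (g z j))
     else 0)"

lemma psi_pos: "0 < x \<Longrightarrow> psi q x = x powr (q - 1)"
  by (simp add: psi_def)

lemma step_norm_pos:
  assumes "z \<in> Spos" "i \<in> I"
  shows "0 < pnorm (p (blk i)) (B (blk i)) (\<lambda>j. psi q (g z j))"
proof -
  have "0 < p (blk i)" using p_gt_1[of "blk i"] by simp
  then have "\<bar>psi q (g z i)\<bar> \<le> pnorm (p (blk i)) (B (blk i)) (\<lambda>j. psi q (g z j))"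
    using abs_le_pnorm[OF finite_B in_B] assms by fast
  moreover have "0 < psi q (g z i)" using g_pos[OF assms] by (simp add: psi_pos)
  ultimately show ?thesis by linarith
qed

lemma step_Spos:
  assumes "z \<in> Spos"
  shows "step z \<in> Spos"
proof -
  have pos: "0 < step z i" if "i \<in> I" for i
    using step_norm_pos[OF assms that] g_pos[OF assms that] rho_pos[of "blk i"] that
    by (simp add: step_def psi_pos)
  moreover have "pnorm (p k) (B k) (step z) = \<rho> k" if "k \<in> blk ` I" for k
  proof -
    from that obtain i where i: "i \<in> I" "blk i = k" by auto
    define h where "h j = psi (conj_exp (p k)) (g z j)" for j
    have N: "0 < pnorm (p k) (B k) h" using step_norm_pos[OF assms i(1)] i(2) unfolding h_def by auto
    have "pnorm (p k) (B k) (step z) = pnorm (p k) (B k) (\<lambda>j. \<rho> k / pnorm (p k) (B k) h * h j)"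
    proof (rule pnorm_cong)
      fix j assume "j \<in> B k"
      then have "j \<in> I" "blk j = k" by (auto simp: B_def)
      then show "step z j = \<rho> k / pnorm (p k) (B k) h * h j"
        unfolding step_def h_def by simp
    qed
    also have "\<dots> = \<rho> k"
      using N rho_pos[of k] p_gt_1[of k] by (subst pnorm_scale) auto
    finally show ?thesis .
  qed
  moreover have "0 \<le> step z i" for i using pos[of i] by (cases "i \<in> I") (auto simp: step_def)
  ultimately show ?thesis by (auto simp: Spos_def S_def step_def)
qed

text \<open>A step is a power of \<open>g\<close> divided by a block norm of such powers. Each of
  the two changes by a factor of at most \<open>exp a\<close>, where \<open>a\<close> is half of the
  allowed amount; this is the origin of the 2 in \<open>g_lip\<close>.\<close>

lemma step_ln_le:
  assumes z: "z \<in> Spos" and z': "z' \<in> Spos" and M: "0 \<le> M" and "close M z z'" and i: "i \<in> I"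
  shows "ln (step z i) - ln (step z' i) \<le> lam * M * b (blk i)"
proof -
  define k where "k = blk i"
  define q where "q = conj_exp (p k)"
  define a where "a = lam * M * b k / 2"
  have cl: "close M z' z" using assms(4) by (auto simp: close_def abs_minus_commute)
  have q: "q - 1 > 0" using p_gt_1[of k] by (simp add: q_def conj_exp_minus_1)
  have *: "psi q (g x j) \<le> exp a * psi q (g y j)"
    if "x \<in> Spos" "y \<in> Spos" "close M x y" "j \<in> B k" for x y j
  proof -
    have j: "j \<in> I" "blk j = k" using that(4) by (auto simp: B_def)
    note pos = g_pos[OF that(1) j(1)] g_pos[OF that(2) j(1)]
    have "2 * (q - 1) * (ln (g x j) - ln (g y j)) \<le> lam * M * b k"
      using g_lip[OF that(1,2) M that(3) j(1)] j(2) by (simp add: q_def)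
    then have "(q - 1) * ln (g x j) \<le> a + (q - 1) * ln (g y j)"
      by (simp add: a_def algebra_simps)
    then show ?thesis using pos by (simp add: psi_pos powr_def flip: exp_add)
  qed
  define N where "N x = pnorm (p k) (B k) (\<lambda>j. psi q (g x j))" for x
  have Npos: "0 < N x" if "x \<in> Spos" for x
    unfolding N_def k_def using step_norm_pos[OF that i] .
  have pk: "0 < p k" using p_gt_1[of k] by simp
  have "N z' \<le> pnorm (p k) (B k) (\<lambda>j. exp a * psi q (g z j))"
    unfolding N_def
  proof (rule pnorm_mono[OF pk])
    fix j assume j: "j \<in> B k"
    then have "0 < psi q (g z' j)" using g_pos[OF z', of j] by (simp add: psi_pos B_def)
    with *[OF z' z cl j] show "\<bar>psi q (g z' j)\<bar> \<le> \<bar>exp a * psi q (g z j)\<bar>" by linarith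
  qed
  also have "\<dots> = exp a * N z" using pk by (simp add: pnorm_scale N_def)
  finally have "ln (N z') \<le> ln (exp a * N z)" using Npos[OF z'] by (intro ln_mono) auto
  then have 1: "ln (N z') \<le> a + ln (N z)" using Npos[OF z] by (simp add: ln_mult)
  have iB: "i \<in> B k" using i by (simp add: B_def k_def)
  have pp: "0 < psi q (g z i)" "0 < psi q (g z' i)" using g_pos[OF z i] g_pos[OF z' i] by (auto simp: psi_pos)
  have "ln (psi q (g z i)) \<le> ln (exp a * psi q (g z' i))"
    using *[OF z z' assms(4) iB] pp by (intro ln_mono) auto
  then have 2: "ln (psi q (g z i)) \<le> a + ln (psi q (g z' i))" using pp by (simp add: ln_mult)
  have ln_step: "ln (step x i) = ln (\<rho> k) + ln (psi q (g x i)) - ln (N x)"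
    if "x \<in> Spos" "0 < psi q (g x i)" for x
  proof -
    have "step x i = \<rho> k * psi q (g x i) / N x"
      using i by (simp add: step_def k_def q_def N_def)
    then show ?thesis using that Npos[OF that(1)] rho_pos[of k] by (simp add: ln_mult ln_div)
  qed
  show ?thesis using 1 2 ln_step[OF z pp(1)] ln_step[OF z' pp(2)] by (simp add: a_def k_def)
qed

lemma step_contraction:
  assumes "z \<in> Spos" "z' \<in> Spos" "0 \<le> M" "close M z z'"
  shows "close (lam * M) (step z) (step z')"
proof -
  have "close M z' z" using assms(4) by (auto simp: close_def abs_minus_commute)
  then show ?thesis
    using step_ln_le[OF assms] step_ln_le[OF assms(2,1,3)] unfolding close_def by (auto simp: abs_le_iff)
qed

lemma close_exists:
  obtains M where "0 \<le> M" "close M z z'"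
proof
  define M where "M = (\<Sum>i\<in>I. \<bar>ln (z i) - ln (z' i)\<bar> / b (blk i))"
  show "0 \<le> M" unfolding M_def using b_pos by (intro sum_nonneg divide_nonneg_pos) auto
  show "close M z z'" unfolding close_def
  proof
    fix i assume "i \<in> I"
    then have "\<bar>ln (z i) - ln (z' i)\<bar> / b (blk i) \<le> M"
      unfolding M_def using b_pos finite_I
      by (intro member_le_sum[of i I "\<lambda>i. \<bar>ln (z i) - ln (z' i)\<bar> / b (blk i)"]) (auto intro: divide_nonneg_pos)
    then show "\<bar>ln (z i) - ln (z' i)\<bar> \<le> M * b (blk i)" using b_pos[of "blk i"] by (simp add: field_simps)
  qed
qed

lemma iterate_close:
  assumes z: "z \<in> Spos" "z' \<in> Spos" and fx: "step z' = z'" and M: "0 \<le> M" "close M z z'"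
  shows "(step ^^ k) z \<in> Spos \<and> close (lam ^ k * M) ((step ^^ k) z) z'"
proof (induction k)
  case 0 then show ?case using z M by simp
next
  case (Suc k)
  then show ?case
    using step_contraction[of "(step ^^ k) z" z' "lam ^ k * M"] z(2) M(1) lam(1) fx
    by (auto intro: step_Spos simp: mult.assoc)
qed

lemma iterate_bound:
  assumes z: "z \<in> Spos" "z' \<in> Spos" and fx: "step z' = z'"
  shows "\<exists>R>0. \<forall>k. \<forall>i\<in>I. \<bar>(step ^^ k) z i - z' i\<bar> \<le> R * lam ^ k"
proof -
  obtain M where M: "0 \<le> M" "close M z z'" by (rule close_exists)
  \<comment> \<open>The summand 1 keeps \<open>R\<close> positive even when
    \<open>M = 0\<close>.\<close>
  define R where "R = 1 + (\<Sum>i\<in>I. \<rho> (blk i) * M * b (blk i))"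
  have nn: "0 \<le> \<rho> (blk i) * M * b (blk i)" for i
    using M b_pos[of "blk i"] rho_pos[of "blk i"] by simp
  have "0 \<le> (\<Sum>i\<in>I. \<rho> (blk i) * M * b (blk i))" using nn by (intro sum_nonneg)
  then have "0 < R" unfolding R_def by linarith
  moreover have "\<bar>(step ^^ k) z i - z' i\<bar> \<le> R * lam ^ k" if i: "i \<in> I" for k i
  proof -
    note it = iterate_close[OF z fx M, of k]
    have "\<bar>(step ^^ k) z i - z' i\<bar> \<le> \<rho> (blk i) * \<bar>ln ((step ^^ k) z i) - ln (z' i)\<bar>"
      using it z(2) i S_le_rho[of _ i] by (intro abs_diff_le_ln_diff) (auto simp: Spos_def)
    also have "\<dots> \<le> \<rho> (blk i) * (lam ^ k * M * b (blk i))"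
      using it i rho_pos[of "blk i"] by (intro mult_left_mono) (auto simp: close_def)
    also have "\<dots> = (\<rho> (blk i) * M * b (blk i)) * lam ^ k" by simp
    also have "\<dots> \<le> R * lam ^ k"
      using member_le_sum[of i I "\<lambda>i. \<rho> (blk i) * M * b (blk i)"] i nn finite_I lam
      by (intro mult_right_mono) (auto simp: R_def)
    finally show ?thesis .
  qed
  ultimately show ?thesis by blast
qed

text \<open>The orbit of a fixed point is constant, yet its distance to the other fixed point is
  bounded by a null sequence.\<close>

lemma fixpoint_unique:
  assumes z: "z \<in> Spos" "z' \<in> Spos" and fx: "step z = z" "step z' = z'"
  shows "z = z'"
proof
  fix i
  show "z i = z' i"
  proof (cases "i \<in> I")
    case True
    obtain R where R: "\<forall>k. \<forall>i\<in>I. \<bar>(step ^^ k) z i - z' i\<bar> \<le> R * lam ^ k"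
      using iterate_bound[OF z fx(2)] by blast
    have it: "(step ^^ k) z = z" for k using fx(1) by (induction k) auto
    have "\<bar>z i - z' i\<bar> \<le> R * lam ^ k" for k using R it True by auto
    moreover have "(\<lambda>k. R * lam ^ k) \<longlonglongrightarrow> R * 0"
      using lam by (intro tendsto_intros LIMSEQ_power_zero) auto
    ultimately have "\<bar>z i - z' i\<bar> \<le> 0" using LIMSEQ_le_const[of _ "0" "\<bar>z i - z' i\<bar>"] by auto
    then show ?thesis by simp
  next
    case False
    then show ?thesis using z by (simp add: Spos_def S_def)
  qed
qed

text \<open>Raising a zero entry by \<open>t\<close> gains at least \<open>\<epsilon> * t\<close>, while restoring the norm by lowering a
  positive entry of the same block costs only \<open>O(t powr p)\<close> with \<open>p > 1\<close>.\<close>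
lemma maximizer_pos:
  assumes z: "z \<in> S" and mx: "\<forall>z'\<in>S. F z' \<le> F z"
  shows "z \<in> Spos"
proof (rule ccontr)
  assume "z \<notin> Spos"
  have zn: "0 \<le> z i" for i using z by (simp add: S_def)
  obtain j where j: "j \<in> I" "z j = 0"
    using \<open>z \<notin> Spos\<close> z zn by (force simp: Spos_def less_le)
  define k where "k = blk j"
  define P where "P = p k"
  have P: "1 < P" using p_gt_1[of k] by (simp add: P_def)
  have "\<exists>m\<in>B k. 0 < z m"
  proof (rule ccontr)
    assume "\<not> (\<exists>m\<in>B k. 0 < z m)"
    then have "\<forall>m\<in>B k. z m = 0" using zn by (force simp: less_le)
    then have "pnorm (p k) (B k) z = 0" by (simp add: pnorm_def)
    moreover have "pnorm (p k) (B k) z = \<rho> k" using z j by (auto simp: S_def k_def)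
    ultimately show False using rho_pos[of k] by simp
  qed
  then obtain m where m: "m \<in> I" "blk m = k" "0 < z m" by (auto simp: B_def)
  have jm: "j \<noteq> m" using j m by auto
  obtain C where C: "\<forall>s\<in>{1/2..1}. F z - F (z(m := s * z m)) \<le> C * (1 - s)"
    using loss_F[OF z m(1)] by auto
  \<comment> \<open>This choice gives \<open>\<bar>C\<bar> * e < \<epsilon> * z m\<close>, also for
    \<open>C = 0\<close>. It is the threshold below which \<open>\<tau> powr (P - 1)\<close> has to
    stay.\<close>
  define e where "e = \<epsilon> * z m / (2 * (\<bar>C\<bar> + 1))"
  have e: "0 < e" using m eps_pos by (simp add: e_def)
  define \<tau> where "\<tau> = min (1/2) (e powr (1 / (P - 1)))"
  have tau: "0 < \<tau>" "\<tau> \<le> 1/2" using e by (auto simp: \<tau>_def)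
  have "\<tau> powr (P - 1) \<le> (e powr (1 / (P - 1))) powr (P - 1)"
    using P tau by (intro powr_mono2) (auto simp: \<tau>_def)
  also have "\<dots> = e" using P e by (simp add: powr_powr)
  finally have tau_e: "\<tau> powr (P - 1) \<le> e" .
  have tauP: "\<tau> powr P = \<tau> * \<tau> powr (P - 1)"
    using tau by (simp add: powr_diff)
  have "\<tau> powr P \<le> \<tau> powr 1" using tau P by (intro powr_mono') auto
  then have tau_half: "\<tau> powr P \<le> 1/2" using tau by simp
  \<comment> \<open>The identity \<open>\<tau> powr P + s powr P = 1\<close> preserves the block
    norm when the zero entry becomes \<open>\<tau> * z m\<close> and \<open>z m\<close> becomes
    \<open>s * z m\<close>.\<close>
  define s where "s = (1 - \<tau> powr P) powr (1 / P)"
  have sP: "s powr P = 1 - \<tau> powr P" using P tau_half by (simp add: s_def powr_powr)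
  have s: "0 \<le> s" "s \<le> 1" using P tau_half by (auto simp: s_def intro!: powr_le1)
  \<comment> \<open>Hence \<open>1 - s \<le> \<tau> powr P\<close>: the cost is of higher order in
    \<tau> than the gain, and \<open>s\<close> stays in the range \<open>{1/2..1}\<close> of
    \<open>loss_F\<close>.\<close>
  have "s powr P \<le> s powr 1" using s P by (intro powr_mono') auto
  then have s_ge: "1 - \<tau> powr P \<le> s" using s by (simp add: sP)
  define t where "t = \<tau> * z m"
  have t: "0 < t" using tau m by (simp add: t_def)
  let ?z1 = "z(m := s * z m)"
  let ?z2 = "z(j := t, m := s * z m)"
  have "t powr P + (s * z m) powr P = z j powr P + z m powr P"
    using s tau m j by (simp add: t_def powr_mult sP algebra_simps)
  then have "?z2 \<in> S"
    using j m jm s t z by (intro S_exchange) (auto simp: k_def P_def)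
  then have "F ?z2 \<le> F z" using mx by auto
  moreover have "F ?z1 + \<epsilon> * t \<le> F (?z1(j := ?z1 j + t))"
    using zn s m j t by (intro gain_F) auto
  moreover have "?z1(j := ?z1 j + t) = ?z2" using jm j by (auto simp: fun_eq_iff)
  moreover have "F z - F ?z1 \<le> C * (1 - s)" using C s s_ge tau_half by auto
  ultimately have "\<epsilon> * t \<le> C * (1 - s)" by simp
  also have "\<dots> \<le> \<bar>C\<bar> * (\<tau> powr P)" using s s_ge by (intro mult_mono) auto
  also have "\<dots> \<le> \<tau> * (\<bar>C\<bar> * e)" unfolding tauP using tau_e tau by (simp add: mult.left_commute mult_left_mono)
  finally have "\<epsilon> * z m \<le> \<bar>C\<bar> * e" using tau by (simp add: t_def mult.left_commute)
  also have "\<dots> < \<epsilon> * z m"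
  proof -
    have "\<bar>C\<bar> * e < (2 * (\<bar>C\<bar> + 1)) * e" using e by (intro mult_strict_right_mono) auto
    also have "\<dots> = \<epsilon> * z m" by (simp add: e_def)
    finally show ?thesis .
  qed
  finally show False by simp
qed

text \<open>Lagrange's condition with the multiplier eliminated: up to a constant factor, the
  multiplier of the block is the common value of the two sides.\<close>

lemma maximizer_stationary:
  assumes z: "z \<in> Spos" and mx: "\<forall>z'\<in>S. F z' \<le> F z"
    and j: "j \<in> I" "m \<in> I" "blk m = blk j" "j \<noteq> m"
  shows "g z j * z j powr (1 - p (blk j)) = g z m * z m powr (1 - p (blk j))"
proof -
  define P where "P = p (blk j)"
  have P: "1 < P" using p_gt_1 by (simp add: P_def)
  have pos: "0 < z j" "0 < z m" using z j by (auto simp: Spos_def)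
  \<comment> \<open>Shifting the p-th powers of two entries by \<open>s\<close> and
    \<open>- s\<close> keeps the curve exactly on the sphere.\<close>
  define c where "c s = z(j := (z j powr P + s) powr (1 / P), m := (z m powr P - s) powr (1 / P))" for s
  define c' where "c' i = (if i = j then z j powr (1 - P) / P else if i = m then - (z m powr (1 - P) / P) else 0)" for i
  have c0: "c 0 = z" using P pos by (auto simp: c_def powr_powr)
  have ee: "(x powr P) powr (1 / P - 1) = x powr (1 - P)" if "0 < x" for x :: real
    using P that by (simp add: powr_powr algebra_simps)
  have d1: "((\<lambda>s. (z j powr P + s) powr (1 / P)) has_real_derivative z j powr (1 - P) / P) (at 0)"
    using pos P by (auto intro!: derivative_eq_intros simp: ee)
  have d2: "((\<lambda>s. (z m powr P - s) powr (1 / P)) has_real_derivative - (z m powr (1 - P) / P)) (at 0)"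
    using pos P by (auto intro!: derivative_eq_intros simp: ee)
  have dc: "\<forall>i\<in>I. ((\<lambda>s. c s i) has_real_derivative c' i) (at 0)"
    using d1 d2 j(4) by (auto simp: c_def c'_def)
  have "((\<lambda>s. F (c s)) has_real_derivative (\<Sum>i\<in>I. g (c 0) i * c' i)) (at 0)"
    using z dc by (intro deriv_F) (auto simp: c0 Spos_def)
  \<comment> \<open>Below \<open>d\<close> both shifted powers are nonnegative for either sign of
    \<open>s\<close>, so 0 is an interior maximum along the curve.\<close>
  moreover define d where "d = min (z j powr P) (z m powr P)"
  moreover have "0 < d" using pos by (simp add: d_def)
  moreover have "F (c s) \<le> F (c 0)" if "\<bar>0 - s\<bar> < d" for s
  proof -
    have "c s \<in> S" unfolding c_def
      using that z j P by (intro S_exchange) (auto simp: d_def Spos_def P_def[symmetric] powr_powr)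
    then show ?thesis using mx by (simp add: c0)
  qed
  ultimately have "(\<Sum>i\<in>I. g (c 0) i * c' i) = 0"
    by (intro DERIV_local_max[of "\<lambda>s. F (c s)" _ 0 d]) auto
  then have "(\<Sum>i\<in>I. g z i * c' i) = 0" by (simp add: c0)
  moreover have "(\<Sum>i\<in>I. g z i * c' i) = (\<Sum>i\<in>{j, m}. g z i * c' i)"
    using j finite_I by (intro sum.mono_neutral_right) (auto simp: c'_def)
  ultimately show ?thesis using j P by (simp add: c'_def P_def[symmetric] field_simps)
qed

text \<open>By stationarity \<open>g z j = c * z j powr (P - 1)\<close> with one \<open>c\<close>
  for the whole block. Since \<open>(conj_exp P - 1) * (P - 1) = 1\<close>, applying
  \<open>psi\<close> inverts this power and returns a multiple of \<open>z\<close>; the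
  normalization removes the multiple.\<close>

lemma maximizer_fixpoint:
  assumes z: "z \<in> Spos" and mx: "\<forall>z'\<in>S. F z' \<le> F z"
  shows "step z = z"
proof
  fix i
  show "step z i = z i"
  proof (cases "i \<in> I")
    case i: True
    define k where "k = blk i"
    define P where "P = p k"
    define c where "c = g z i * z i powr (1 - P)"
    define a where "a = c powr (1 / (P - 1))"
    have P: "1 < P" using p_gt_1 by (simp add: P_def)
    have zi: "0 < z i" using z i by (simp add: Spos_def)
    have c: "0 < c" unfolding c_def using zi g_pos[OF z i] by simp
    then have a: "0 < a" by (simp add: a_def)
    have psi: "psi (conj_exp P) (g z j) = a * z j" if "j \<in> B k" for j
    proof -
      have j: "j \<in> I" "blk j = k" using that by (auto simp: B_def)
      have zj: "0 < z j" using z j by (auto simp: Spos_def)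
      have "g z j * z j powr (1 - P) = c"
      proof (cases "i = j")
        case False
        then have "g z i * z i powr (1 - p (blk i)) = g z j * z j powr (1 - p (blk i))"
          using j(2) by (intro maximizer_stationary[OF z mx i j(1)]) (simp_all add: k_def)
        then show ?thesis by (simp add: c_def k_def P_def)
      qed (simp add: c_def)
      moreover have "g z j = g z j * z j powr (1 - P) * z j powr (P - 1)"
        using zj by (simp add: mult.assoc flip: powr_add)
      ultimately have gj: "g z j = c * z j powr (P - 1)" by simp
      have "psi (conj_exp P) (g z j) = g z j powr (1 / (P - 1))"
        using psi_pos[OF g_pos[OF z j(1)]] by (simp add: conj_exp_minus_1[OF P])
      also have "\<dots> = a * z j" unfolding gj a_def using P zj c by (simp add: powr_mult powr_powr)
      finally show ?thesis .
    qed
    have "pnorm P (B k) (\<lambda>j. psi (conj_exp P) (g z j)) = pnorm P (B k) (\<lambda>j. a * z j)"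
      by (intro pnorm_cong psi)
    also have "\<dots> = a * \<rho> k"
      using z P a i by (subst pnorm_scale) (auto simp: Spos_def S_def k_def P_def)
    finally show ?thesis
      using i psi[of i] in_B[OF i] a rho_pos[of k] by (simp add: step_def k_def P_def)
  next
    case False
    then show ?thesis using z by (simp add: step_def Spos_def S_def)
  qed
qed

text \<open>Uniqueness is obtained without concavity of \<open>F\<close>: every maximizer is a
  positive fixed point of \<open>step\<close>, and a contraction has at most one. The fixed point
  itself is supplied by compactness.\<close>

theorem unique_maximizer_and_convergence:
  "\<exists>zs\<in>Spos. (\<forall>z\<in>S. F z \<le> F zs) \<and> (\<forall>z\<in>S. (\<forall>z'\<in>S. F z' \<le> F z) \<longrightarrow> z = zs)
     \<and> (\<forall>z0\<in>Spos. \<exists>R>0. \<forall>k. \<forall>i\<in>I. \<bar>(step ^^ k) z0 i - zs i\<bar> \<le> R * lam ^ k)"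
proof -
  have "continuous_on S F" by (rule continuous_on_subset[OF cont_F]) (auto simp: S_def)
  then obtain zs where zs: "zs \<in> S" "\<forall>z\<in>S. F z \<le> F zs"
    using continuous_attains_sup[OF compact_S S_nonempty] by blast
  have pos: "zs \<in> Spos" using maximizer_pos[OF zs] .
  have fx: "step zs = zs" using maximizer_fixpoint[OF pos zs(2)] .
  have "z = zs" if "z \<in> S" "\<forall>z'\<in>S. F z' \<le> F z" for z
    using fixpoint_unique[OF maximizer_pos[OF that] pos maximizer_fixpoint[OF maximizer_pos[OF that] that(2)] fx] .
  then show ?thesis using zs pos iterate_bound[OF _ pos fx] by blast
qed

end

section \<open>Hoelder bounds and the cross-entropy loss\<close>

lemma Hoelder_sum:
  fixes a c :: "'i \<Rightarrow> real"
  assumes "finite A" "1 < p" "1 < q" "1 / p + 1 / q = 1" "\<And>i. i \<in> A \<Longrightarrow> 0 \<le> a i" "\<And>i. i \<in> A \<Longrightarrow> 0 \<le> c i"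
  shows "(\<Sum>i\<in>A. a i * c i) \<le> pnorm p A a * pnorm q A c"
proof (cases "pnorm p A a = 0 \<or> pnorm q A c = 0")
  case True
  have "a i * c i = 0" if "i \<in> A" for i
    using True abs_le_pnorm[OF assms(1) that, of p a] abs_le_pnorm[OF assms(1) that, of q c] assms by auto
  then show ?thesis using pnorm_nonneg[of p A a] pnorm_nonneg[of q A c] by simp
next
  case False
  define M N where "M = pnorm p A a" and "N = pnorm q A c"
  have MN: "0 < M" "0 < N" using False by (simp_all add: M_def N_def less_le)
  have "(\<Sum>i\<in>A. (a i / M) * (c i / N)) \<le> (\<Sum>i\<in>A. (a i / M) powr p / p + (c i / N) powr q / q)"
    using assms MN by (intro sum_mono Youngs_inequality) auto
  also have "\<dots> = (\<Sum>i\<in>A. \<bar>a i\<bar> powr p) / M powr p / p + (\<Sum>i\<in>A. \<bar>c i\<bar> powr q) / N powr q / q"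
    using assms MN by (simp add: sum.distrib sum_divide_distrib powr_divide)
  also have "(\<Sum>i\<in>A. \<bar>a i\<bar> powr p) = M powr p"
    using pnorm_eq_iff[of p M A a] assms MN by (simp add: M_def)
  also have "(\<Sum>i\<in>A. \<bar>c i\<bar> powr q) = N powr q"
    using pnorm_eq_iff[of q N A c] assms MN by (simp add: N_def)
  finally have "(\<Sum>i\<in>A. (a i / M) * (c i / N)) \<le> 1" using MN assms by simp
  moreover have "(\<Sum>i\<in>A. (a i / M) * (c i / N)) = (\<Sum>i\<in>A. a i * c i) / (M * N)"
    by (simp add: sum_divide_distrib)
  ultimately show ?thesis using MN by (simp add: M_def N_def divide_le_eq)
qed

lemma conj_exp_props:
  assumes "1 < p"
  shows "1 < conj_exp p" "1 / p + 1 / conj_exp p = 1"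
  using assms by (auto simp: conj_exp_def field_simps)

text \<open>The shares \<open>a\<close> lie in the unit ball of exponent \<open>q\<close>, and the
  p-th power of a term carries \<open>a l powr (\<gamma> l * p)\<close>. If
  \<open>\<gamma> l * p \<ge> q\<close>, this is at most \<open>a l powr q\<close>, so the shares
  act as weights of total at most 1 and a maximum suffices. Otherwise the exponents are first
  lowered to \<open>gb * p\<close>, possible since shares are at most 1, and then Hoelder applies.
  The two halves of \<open>PsiFun\<close> are these two cases.\<close>

lemma pnorm_le_PsiFun:
  assumes q: "1 < q" and p: "1 < p" and \<gamma>: "\<And>l. l < r \<Longrightarrow> 1 \<le> \<gamma> l" and \<delta>: "\<And>l. l < r \<Longrightarrow> 0 \<le> \<delta> l"
    and t: "0 \<le> t" and a: "\<And>l. l < r \<Longrightarrow> 0 \<le> a l" "(\<Sum>l<r. a l powr q) \<le> 1"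
    and h: "\<And>l. l < r \<Longrightarrow> 0 \<le> h l" "\<And>l. l < r \<Longrightarrow> h l \<le> a l * t"
  shows "pnorm p {..<r} (\<lambda>l. \<delta> l * h l powr \<gamma> l) \<le> PsiFun r \<gamma> p q \<delta> t"
proof -
  define J where "J = {l \<in> {..<r}. \<gamma> l * p < q}"
  define Jc where "Jc = {l \<in> {..<r}. \<gamma> l * p \<ge> q}"
  define gb where "gb = Min (\<gamma> ` J)"
  define D where "D l = \<delta> l * t powr \<gamma> l" for l
  have fin: "finite J" "finite Jc" by (auto simp: J_def Jc_def)
  have D: "0 \<le> D l" if "l < r" for l using \<delta>[OF that] by (simp add: D_def)
  have a1: "a l \<le> 1" if "l < r" for l
  proof (rule ccontr)
    assume "\<not> a l \<le> 1"
    then have "1 powr q < a l powr q" using q by (intro powr_less_mono2) auto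
    also have "\<dots> \<le> (\<Sum>l<r. a l powr q)" using that by (intro member_le_sum) auto
    finally show False using a(2) by simp
  qed
  have term_le: "\<bar>\<delta> l * h l powr \<gamma> l\<bar> powr p \<le> D l powr p * a l powr (\<gamma> l * p)" if l: "l < r" for l
  proof -
    have "h l powr \<gamma> l \<le> (a l * t) powr \<gamma> l" using h[OF l] \<gamma>[OF l] by (intro powr_mono2) auto
    also have "\<dots> = t powr \<gamma> l * a l powr \<gamma> l" using a(1)[OF l] t by (simp add: powr_mult)
    finally have "\<delta> l * h l powr \<gamma> l \<le> D l * a l powr \<gamma> l"
      unfolding D_def mult.assoc using \<delta>[OF l] by (rule mult_left_mono)
    moreover have "0 \<le> \<delta> l * h l powr \<gamma> l" using \<delta>[OF l] by simp
    ultimately have "\<bar>\<delta> l * h l powr \<gamma> l\<bar> powr p \<le> (D l * a l powr \<gamma> l) powr p"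
      using p by (intro powr_mono2) auto
    also have "\<dots> = D l powr p * a l powr (\<gamma> l * p)" using D[OF l] by (simp add: powr_mult powr_powr)
    finally show ?thesis .
  qed
  have J_part: "(\<Sum>l\<in>J. D l powr p * a l powr (\<gamma> l * p))
      \<le> (\<Sum>l\<in>J. D l powr (p * q / (q - gb * p))) powr (1 - gb * p / q)"
  proof (cases "J = {}")
    \<comment> \<open>For empty \<open>J\<close> the minimum \<open>gb\<close> is unspecified, but
      both sides are 0 because 0 to any power is 0.\<close>
    case True then show ?thesis by simp
  next
    case False
    have "gb \<in> \<gamma> ` J" unfolding gb_def using False fin by (intro Min_in) auto
    then have gb: "1 \<le> gb" "gb * p < q" using \<gamma> by (auto simp: J_def)
    have gbp: "0 < gb * p" using gb p by simp
    \<comment> \<open>With this exponent the norm of \<open>a l powr (gb * p)\<close> becomes a root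
      of the sum of \<open>a l powr q\<close>, which is at most 1; the conjugate exponent
      \<open>s'\<close> produces the exponents seen in \<open>PsiFun\<close>.\<close>
    define s where "s = q / (gb * p)"
    define s' where "s' = q / (q - gb * p)"
    have s: "1 < s" "1 < s'" "1 / s + 1 / s' = 1" using gb gbp q by (auto simp: s_def s'_def field_simps)
    have "(\<Sum>l\<in>J. D l powr p * a l powr (\<gamma> l * p)) \<le> (\<Sum>l\<in>J. a l powr (gb * p) * D l powr p)"
    proof (rule sum_mono)
      fix l assume l: "l \<in> J"
      then have "gb \<le> \<gamma> l" unfolding gb_def using fin by (intro Min_le) auto
      moreover have "l < r" using l by (simp add: J_def)
      ultimately have "a l powr (\<gamma> l * p) \<le> a l powr (gb * p)"
        using p a a1 by (intro powr_mono') (auto intro: mult_right_mono)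
      then show "D l powr p * a l powr (\<gamma> l * p) \<le> a l powr (gb * p) * D l powr p"
        by (metis mult.commute mult_left_mono powr_ge_zero)
    qed
    also have "\<dots> \<le> pnorm s J (\<lambda>l. a l powr (gb * p)) * pnorm s' J (\<lambda>l. D l powr p)"
      using s fin by (intro Hoelder_sum) auto
    also have "\<dots> \<le> 1 * pnorm s' J (\<lambda>l. D l powr p)"
    proof (rule mult_right_mono)
      have "(\<Sum>l\<in>J. \<bar>a l powr (gb * p)\<bar> powr s) = (\<Sum>l\<in>J. a l powr q)"
        using gb(1) p by (simp add: powr_powr s_def)
      also have "\<dots> \<le> (\<Sum>l<r. a l powr q)" by (intro sum_mono2) (auto simp: J_def)
      also have "\<dots> \<le> 1" by (rule a(2))
      finally show "pnorm s J (\<lambda>l. a l powr (gb * p)) \<le> 1"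
        unfolding pnorm_def using s by (intro powr_le1) (auto simp: sum_nonneg abs_of_nonneg)
    qed (rule pnorm_nonneg)
    also have "\<dots> = (\<Sum>l\<in>J. D l powr (p * q / (q - gb * p))) powr (1 - gb * p / q)"
      using gb gbp q by (simp add: pnorm_def powr_powr s'_def diff_divide_distrib)
    finally show ?thesis .
  qed
  have Jc_part: "(\<Sum>l\<in>Jc. D l powr p * a l powr (\<gamma> l * p)) \<le> (if Jc = {} then 0 else Max ((\<lambda>j. D j powr p) ` Jc))"
  proof (cases "Jc = {}")
    case True then show ?thesis by simp
  next
    case False
    define m where "m = Max ((\<lambda>j. D j powr p) ` Jc)"
    have m: "D l powr p \<le> m" if "l \<in> Jc" for l unfolding m_def using that fin by (intro Max_ge) auto
    have m0: "0 \<le> m" using False m by (meson all_not_in_conv order_trans powr_ge_zero)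
    have "(\<Sum>l\<in>Jc. D l powr p * a l powr (\<gamma> l * p)) \<le> (\<Sum>l\<in>Jc. m * a l powr q)"
      using m m0 a a1 by (intro sum_mono mult_mono powr_mono') (auto simp: Jc_def)
    also have "\<dots> = m * (\<Sum>l\<in>Jc. a l powr q)" by (simp add: sum_distrib_left)
    also have "\<dots> \<le> m * (\<Sum>l<r. a l powr q)" using m0 by (intro mult_left_mono sum_mono2) (auto simp: Jc_def)
    also have "\<dots> \<le> m * 1" using m0 a(2) by (intro mult_left_mono)
    finally show ?thesis using False by (simp add: m_def)
  qed
  have "(\<Sum>l<r. \<bar>\<delta> l * h l powr \<gamma> l\<bar> powr p) \<le> (\<Sum>l<r. D l powr p * a l powr (\<gamma> l * p))"
    using term_le by (intro sum_mono) auto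
  also have "{..<r} = J \<union> Jc" by (auto simp: J_def Jc_def)
  also have "(\<Sum>l\<in>J \<union> Jc. D l powr p * a l powr (\<gamma> l * p))
      = (\<Sum>l\<in>J. D l powr p * a l powr (\<gamma> l * p)) + (\<Sum>l\<in>Jc. D l powr p * a l powr (\<gamma> l * p))"
    using fin by (intro sum.union_disjoint) (auto simp: J_def Jc_def)
  finally have le: "(\<Sum>l\<in>J \<union> Jc. \<bar>\<delta> l * h l powr \<gamma> l\<bar> powr p)
    \<le> (\<Sum>l\<in>J. D l powr (p * q / (q - gb * p))) powr (1 - gb * p / q)
       + (if Jc = {} then 0 else Max ((\<lambda>j. D j powr p) ` Jc))"
    using J_part Jc_part by linarith
  have "J \<union> Jc = {..<r}" by (auto simp: J_def Jc_def)
  then have "pnorm p {..<r} (\<lambda>l. \<delta> l * h l powr \<gamma> l) = (\<Sum>l\<in>J \<union> Jc. \<bar>\<delta> l * h l powr \<gamma> l\<bar> powr p) powr (1 / p)"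
    by (simp add: pnorm_def)
  also have "\<dots> \<le> PsiFun r \<gamma> p q \<delta> t"
    unfolding PsiFun_def Let_def J_def[symmetric] Jc_def[symmetric] gb_def[symmetric] D_def[symmetric]
    using p le by (intro powr_mono2 sum_nonneg) auto
  finally show ?thesis .
qed

text \<open>Hoelder pairs the weights \<open>c\<close> with the activations. Taking
  \<open>\<delta> = 1\<close> bounds a layer itself, taking \<open>\<delta> = \<beta>\<close> bounds
  the output weighted by its exponents; this is how \<theta>, \<open>Cw\<close> and
  \<open>Cv\<close> arise.\<close>

lemma layer_bound:
  assumes q: "1 < q" and p: "1 < p" and \<gamma>: "\<And>l. l < r \<Longrightarrow> 1 \<le> \<gamma> l" and \<delta>: "\<And>l. l < r \<Longrightarrow> 0 \<le> \<delta> l"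
    and t: "0 \<le> t" and a: "\<And>l. l < r \<Longrightarrow> 0 \<le> a l" "(\<Sum>l<r. a l powr q) \<le> 1"
    and h: "\<And>l. l < r \<Longrightarrow> 0 \<le> h l" "\<And>l. l < r \<Longrightarrow> h l \<le> a l * t"
    and c: "\<And>l. l < r \<Longrightarrow> 0 \<le> c l"
  shows "(\<Sum>l<r. c l * (\<delta> l * h l powr \<gamma> l)) \<le> pnorm p {..<r} c * PsiFun r \<gamma> (conj_exp p) q \<delta> t"
proof -
  have "(\<Sum>l<r. c l * (\<delta> l * h l powr \<gamma> l)) \<le> pnorm p {..<r} c * pnorm (conj_exp p) {..<r} (\<lambda>l. \<delta> l * h l powr \<gamma> l)"
    using p c \<delta> conj_exp_props[OF p] by (intro Hoelder_sum) auto
  also have "\<dots> \<le> pnorm p {..<r} c * PsiFun r \<gamma> (conj_exp p) q \<delta> t"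
    using assms conj_exp_props[OF p] pnorm_nonneg
    by (intro mult_left_mono pnorm_le_PsiFun[where a=a]) auto
  finally show ?thesis .
qed

section \<open>Calculus of relative bounds \<open>x \<le> exp m * y\<close>\<close>

lemma diff_le_of_le_exp_mult:
  fixes x y L :: real
  assumes "0 \<le> x" "x \<le> exp L * y"
  shows "x - y \<le> L * x"
proof -
  have "exp (- L) * x \<le> y" using assms(2) by (simp add: exp_minus field_simps)
  moreover have "(1 - L) * x \<le> exp (- L) * x"
    using exp_ge_add_one_self[of "- L"] assms(1) by (intro mult_right_mono) auto
  ultimately show ?thesis by (simp add: algebra_simps)
qed

lemma powr_le_exp_mult:
  fixes x y :: real
  assumes "0 \<le> x" "0 \<le> y" "x \<le> exp m * y" "0 \<le> a"
  shows "x powr a \<le> exp (a * m) * y powr a"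
proof -
  have "x powr a \<le> (exp m * y) powr a" using assms by (intro powr_mono2) auto
  also have "\<dots> = exp (a * m) * y powr a" using assms by (simp add: powr_mult) (simp add: powr_def)
  finally show ?thesis .
qed

lemma mult_le_exp_mult:
  fixes x y x' y' :: real
  assumes "x \<le> exp m * x'" "y \<le> exp k * y'" "0 \<le> y" "0 \<le> x'"
  shows "x * y \<le> exp (m + k) * (x' * y')"
proof -
  have "x * y \<le> (exp m * x') * (exp k * y')" using assms by (intro mult_mono) auto
  then show ?thesis by (simp add: exp_add mult_ac)
qed

lemma le_exp_mult_mono:
  fixes x y :: real
  assumes "x \<le> exp a * y" "a \<le> b" "0 \<le> y"
  shows "x \<le> exp b * y"
proof -
  have "exp a * y \<le> exp b * y" using assms by (intro mult_right_mono) auto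
  then show ?thesis using assms by linarith
qed

lemma sum_le_exp_mult:
  fixes f h :: "'i \<Rightarrow> real"
  assumes "\<And>i. i \<in> A \<Longrightarrow> f i \<le> exp m * h i"
  shows "sum f A \<le> exp m * sum h A"
  using sum_mono[of A f "\<lambda>i. exp m * h i"] assms by (simp add: sum_distrib_left)

text \<open>The partial derivative of the negative loss plus the sum of all outputs with respect to
  output \<open>r\<close>.\<close>

definition loss_coeff :: "nat \<Rightarrow> nat \<Rightarrow> (nat \<Rightarrow> real) \<Rightarrow> nat \<Rightarrow> real" where
  "loss_coeff K y f r = (if r = y then 1 else 0) + (1 - exp (f r) / (\<Sum>j<K. exp (f j)))"

text \<open>Writing 1 minus a softmax entry as a quotient of sums of positive terms removes the
  subtraction, which would block a relative bound.\<close>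

lemma loss_coeff_altdef:
  assumes "r < K"
  shows "loss_coeff K y f r = (if r = y then 1 else 0) + (\<Sum>j\<in>{..<K}-{r}. exp (f j)) / (\<Sum>j<K. exp (f j))"
proof -
  have "0 < (\<Sum>j<K. exp (f j))" using assms by (intro sum_pos) auto
  moreover have "(\<Sum>j<K. exp (f j)) = exp (f r) + (\<Sum>j\<in>{..<K}-{r}. exp (f j))"
    using assms by (intro sum.remove) auto
  ultimately show ?thesis by (simp add: loss_coeff_def field_simps)
qed

lemma loss_coeff_nonneg:
  assumes "r < K"
  shows "0 \<le> loss_coeff K y f r"
  unfolding loss_coeff_altdef[OF assms] by (auto intro!: add_nonneg_nonneg divide_nonneg_nonneg sum_nonneg)

text \<open>Numerator and denominator each contribute a factor \<open>exp D\<close>; the indicator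
  of the label is constant and only uses \<open>1 \<le> exp (2 * D)\<close>.\<close>

lemma loss_coeff_le:
  assumes "r < K" and "\<And>j. j < K \<Longrightarrow> \<bar>f j - f' j\<bar> \<le> D"
  shows "loss_coeff K y f r \<le> exp (2 * D) * loss_coeff K y f' r"
proof -
  have D: "0 \<le> D" using assms(2)[OF assms(1)] by linarith
  define s s' where "s = (\<Sum>j<K. exp (f j))" and "s' = (\<Sum>j<K. exp (f' j))"
  have pos: "0 < s" "0 < s'" using assms(1) unfolding s_def s'_def by (auto intro!: sum_pos)
  have "exp (f j) \<le> exp D * exp (f' j)" "exp (f' j) \<le> exp D * exp (f j)" if "j < K" for j
    using assms(2)[OF that] by (auto simp flip: exp_add)
  then have num: "(\<Sum>j\<in>{..<K}-{r}. exp (f j)) \<le> exp D * (\<Sum>j\<in>{..<K}-{r}. exp (f' j))"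
    and den: "s' \<le> exp D * s" unfolding s_def s'_def by (auto intro!: sum_le_exp_mult)
  have "(\<Sum>j\<in>{..<K}-{r}. exp (f j)) / s \<le> (exp D * (\<Sum>j\<in>{..<K}-{r}. exp (f' j))) / (s' / exp D)"
    using num den pos by (intro frac_le) (auto simp: field_simps intro!: sum_nonneg mult_nonneg_nonneg)
  also have "\<dots> = exp (2 * D) * ((\<Sum>j\<in>{..<K}-{r}. exp (f' j)) / s')"
    by (simp only: mult_2 exp_add) (simp add: field_simps)
  finally have 1: "(\<Sum>j\<in>{..<K}-{r}. exp (f j)) / s \<le> exp (2 * D) * ((\<Sum>j\<in>{..<K}-{r}. exp (f' j)) / s')" .
  have "1 \<le> exp (2 * D)" using D by simp
  then show ?thesis using 1
    unfolding loss_coeff_altdef[OF assms(1)] s_def[symmetric] s'_def[symmetric] by (auto simp: distrib_left intro!: add_mono)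
qed

text \<open>Let T be the total increase of the outputs. The log-sum-exp term grows by something
  between 0 and T. The lower end yields the bound \<open>2 * T\<close> on the gain; the upper end is
  compensated by the added sum of outputs, which yields monotonicity.\<close>

lemma neg_ce_loss_diff_le:
  assumes "y < K" and "\<And>j. j < K \<Longrightarrow> f' j \<le> f j"
  shows "(- ce_loss K y f + (\<Sum>r<K. f r)) - (- ce_loss K y f' + (\<Sum>r<K. f' r)) \<le> 2 * (\<Sum>r<K. f r - f' r)"
    and "- ce_loss K y f' + (\<Sum>r<K. f' r) \<le> - ce_loss K y f + (\<Sum>r<K. f r)"
proof -
  define s s' T where "s = (\<Sum>j<K. exp (f j))" and "s' = (\<Sum>j<K. exp (f' j))"
    and "T = (\<Sum>r<K. f r - f' r)"
  have pos: "0 < s" "0 < s'" using assms(1) unfolding s_def s'_def by (auto intro!: sum_pos)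
  have "s' \<le> s" unfolding s_def s'_def using assms(2) by (intro sum_mono) auto
  then have ln1: "ln s' \<le> ln s" using pos by simp
  have T: "f r - f' r \<le> T" if "r < K" for r
    unfolding T_def using that assms(2) by (intro member_le_sum[of r _ "\<lambda>r. f r - f' r"]) auto
  have "s \<le> exp T * s'" unfolding s_def s'_def
    using T by (intro sum_le_exp_mult) (force simp flip: exp_add)
  then have "ln s \<le> ln (exp T * s')" using pos by (intro ln_mono) auto
  then have ln2: "ln s \<le> T + ln s'" using pos by (simp add: ln_mult)
  have sums: "(\<Sum>r<K. f r) - (\<Sum>r<K. f' r) = T" by (simp add: T_def sum_subtractf)
  show "(- ce_loss K y f + (\<Sum>r<K. f r)) - (- ce_loss K y f' + (\<Sum>r<K. f' r)) \<le> 2 * (\<Sum>r<K. f r - f' r)"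
    using ln1 sums T[OF assms(1)] unfolding ce_loss_def s_def[symmetric] s'_def[symmetric] T_def[symmetric] by linarith
  show "- ce_loss K y f' + (\<Sum>r<K. f' r) \<le> - ce_loss K y f + (\<Sum>r<K. f r)"
    using ln2 sums assms(2)[OF assms(1)] unfolding ce_loss_def s_def[symmetric] s'_def[symmetric] by linarith
qed

lemma neg_ce_loss_deriv:
  assumes "y < K" and f: "\<And>j. j < K \<Longrightarrow> ((\<lambda>s. f s j) has_real_derivative f' j) (at t)"
  shows "((\<lambda>s. - ce_loss K y (f s) + (\<Sum>r<K. f s r)) has_real_derivative
           (\<Sum>r<K. loss_coeff K y (f t) r * f' r)) (at t)"
proof -
  define E where "E = (\<Sum>j<K. exp (f t j))"
  have E: "0 < E" unfolding E_def using assms(1) by (intro sum_pos) auto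
  have "((\<lambda>s. - (- f s y + ln (\<Sum>j<K. exp (f s j))) + (\<Sum>r<K. f s r)) has_real_derivative
      - (- f' y + (\<Sum>j<K. exp (f t j) * f' j) / E) + (\<Sum>r<K. f' r)) (at t)"
    using assms E unfolding E_def by (auto intro!: derivative_eq_intros simp: divide_inverse mult_ac)
  moreover have eq: "(\<Sum>r<K. loss_coeff K y (f t) r * f' r)
      = (\<Sum>r<K. if r = y then f' r else 0) + ((\<Sum>r<K. f' r) - (\<Sum>j<K. exp (f t j) * f' j) / E)"
    unfolding loss_coeff_def E_def[symmetric] sum_divide_distrib sum_subtractf[symmetric] sum.distrib[symmetric]
    by (intro sum.cong) (auto simp: algebra_simps)
  moreover from eq have "(\<Sum>r<K. loss_coeff K y (f t) r * f' r)
      = - (- f' y + (\<Sum>j<K. exp (f t j) * f' j) / E) + (\<Sum>r<K. f' r)"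
    using assms(1) by simp
  ultimately show ?thesis unfolding ce_loss_def by (simp only:)
qed

section \<open>Two-hidden-layer networks\<close>

lemma sum_rotate:
  "(\<Sum>a\<in>A. \<Sum>b\<in>B. \<Sum>c\<in>C. f a b c) = (\<Sum>b\<in>B. \<Sum>c\<in>C. \<Sum>a\<in>A. (f a b c :: real))"
  by (subst sum.swap) (intro sum.cong refl sum.swap)

text \<open>Turns a derivative nested like the network into a gradient paired with the direction
  \<open>w'\<close>, \<open>v'\<close>, \<open>u'\<close>. \<open>H\<close> and \<open>Q\<close>
  stand for the powers in the outer and inner layer, \<open>E\<close> and \<open>T\<close> for the
  derivatives of these powers.\<close>

lemma collect_chain_rule:
  fixes k :: "nat \<Rightarrow> real"
  shows "(\<Sum>r<K. k r * (\<Sum>l<n2. w' r l * H l + w r l * (E l * (\<Sum>m<n1. v' l m * Q m + v l m * (T m * (\<Sum>s<d. u' m s * x s))))))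
    = (\<Sum>r<K. \<Sum>l<n2. (k r * H l) * w' r l)
    + (\<Sum>l<n2. \<Sum>m<n1. (\<Sum>r<K. k r * (w r l * (E l * Q m))) * v' l m)
    + (\<Sum>m<n1. \<Sum>s<d. (\<Sum>r<K. k r * (\<Sum>l<n2. w r l * (E l * (v l m * (T m * x s))))) * u' m s)"
proof -
  have 1: "k r * (\<Sum>l<n2. w' r l * H l + w r l * (E l * (\<Sum>m<n1. v' l m * Q m + v l m * (T m * (\<Sum>s<d. u' m s * x s)))))
    = (\<Sum>l<n2. (k r * H l) * w' r l) + (\<Sum>l<n2. \<Sum>m<n1. k r * (w r l * (E l * Q m)) * v' l m)
      + (\<Sum>l<n2. \<Sum>m<n1. \<Sum>s<d. k r * (w r l * (E l * (v l m * (T m * x s)))) * u' m s)" for r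
    by (simp add: sum_distrib_left sum_distrib_right sum.distrib distrib_left mult_ac add_ac)
  have 2: "(\<Sum>r<K. \<Sum>l<n2. \<Sum>m<n1. k r * (w r l * (E l * Q m)) * v' l m)
      = (\<Sum>l<n2. \<Sum>m<n1. (\<Sum>r<K. k r * (w r l * (E l * Q m))) * v' l m)"
    by (subst sum_rotate) (simp add: sum_distrib_right)
  have "(\<Sum>l<n2. \<Sum>m<n1. \<Sum>s<d. k r * (w r l * (E l * (v l m * (T m * x s)))) * u' m s)
      = (\<Sum>m<n1. \<Sum>s<d. (k r * (\<Sum>l<n2. w r l * (E l * (v l m * (T m * x s))))) * u' m s)" for r
    by (subst sum_rotate) (simp add: sum_distrib_right sum_distrib_left)
  then have 3: "(\<Sum>r<K. \<Sum>l<n2. \<Sum>m<n1. \<Sum>s<d. k r * (w r l * (E l * (v l m * (T m * x s)))) * u' m s)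
      = (\<Sum>m<n1. \<Sum>s<d. (\<Sum>r<K. k r * (\<Sum>l<n2. w r l * (E l * (v l m * (T m * x s))))) * u' m s)"
    by (simp only:) (subst sum_rotate, simp add: sum_distrib_right)
  show ?thesis unfolding 1 unfolding sum.distrib 2 3 ..
qed

lemma average_rotate:
  fixes a :: real
  shows "a * (\<Sum>i\<in>A. \<Sum>x\<in>B. \<Sum>y\<in>C. g i x y * h x y) = (\<Sum>x\<in>B. \<Sum>y\<in>C. (a * (\<Sum>i\<in>A. g i x y)) * h x y)"
  by (subst sum_rotate) (simp add: sum_distrib_left sum_distrib_right mult.assoc)

text \<open>The constant case covers inputs \<open>x = 0\<close>; there the formula holds because \<open>0 powr a = 0\<close>.\<close>
lemma deriv_powr_pos_or_const_0:
  fixes h :: "real \<Rightarrow> real"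
  assumes "(h has_real_derivative h') (at t)" and "0 < h t \<or> (\<forall>s. h s = 0)"
  shows "((\<lambda>s. h s powr a) has_real_derivative a * h t powr (a - 1) * h') (at t)"
proof (cases "0 < h t")
  case True
  then show ?thesis using DERIV_chain2[OF has_real_derivative_powr assms(1)] by simp
next
  case False
  then show ?thesis using assms(2) by simp
qed

text \<open>The row norms of a matrix on its sphere, divided by the radius, are the shares
  \<open>a\<close> that \<open>layer_bound\<close> asks for.\<close>

lemma sum_row_pnorms:
  assumes "mnorm q a c M = r" "0 < r" "1 < q"
  shows "(\<Sum>i<a. (pnorm q {..<c} (M i) / r) powr q) = 1"
proof -
  have "(\<Sum>i<a. (pnorm q {..<c} (M i) / r) powr q) = (\<Sum>i<a. (\<Sum>j<c. \<bar>M i j\<bar> powr q) / r powr q)"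
  proof (intro sum.cong refl)
    fix i
    have "pnorm q {..<c} (M i) powr q = (\<Sum>j<c. \<bar>M i j\<bar> powr q)"
      using pnorm_eq_iff[of q "pnorm q {..<c} (M i)" "{..<c}" "M i"] assms(3) by simp
    then show "(pnorm q {..<c} (M i) / r) powr q = (\<Sum>j<c. \<bar>M i j\<bar> powr q) / r powr q"
      using assms(2) pnorm_nonneg[of q "{..<c}" "M i"] by (simp add: powr_divide)
  qed
  also have "\<dots> = (\<Sum>x\<in>{..<a} \<times> {..<c}. \<bar>case x of (i, j) \<Rightarrow> M i j\<bar> powr q) / r powr q"
    by (simp add: sum.cartesian_product sum_divide_distrib[symmetric] case_prod_beta)
  also have "(\<Sum>x\<in>{..<a} \<times> {..<c}. \<bar>case x of (i, j) \<Rightarrow> M i j\<bar> powr q) = r powr q"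
    using assms pnorm_eq_iff[of q r "{..<a} \<times> {..<c}" "\<lambda>(i, j). M i j"] by (simp add: mnorm_def)
  finally show ?thesis using assms(2) by simp
qed

text \<open>One index type for the three matrices makes a parameter triple a single function, as
  \<open>multi_sphere\<close> expects. The constructors accept all naturals; the set
  \<open>I\<close> below selects the actual positions.\<close>

datatype idx = W nat nat | V nat nat | U nat nat

definition unflat :: "(idx \<Rightarrow> real) \<Rightarrow> params" where
  "unflat z = (\<lambda>i j. z (W i j), \<lambda>i j. z (V i j), \<lambda>i j. z (U i j))"

definition flat :: "params \<Rightarrow> idx \<Rightarrow> real" where
  "flat P = (case P of (w, v, u) \<Rightarrow> case_idx w v u)"

lemma unflat_flat [simp]: "unflat (flat P) = P"
  by (cases P) (simp add: unflat_def flat_def)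

lemma flat_unflat [simp]: "flat (unflat z) = z"
  by (rule ext, rename_tac i, case_tac i) (auto simp: unflat_def flat_def)

locale network =
  fixes n K n1 n2 d :: nat and X :: "nat \<Rightarrow> nat \<Rightarrow> real" and Y :: "nat \<Rightarrow> nat"
    and pw pv pu \<rho>w \<rho>v \<rho>u \<epsilon> :: real and \<alpha> \<beta> :: "nat \<Rightarrow> real"
  assumes sizes: "1 \<le> n" "1 \<le> n1" "1 \<le> n2" "1 \<le> d"
    and X_nonneg: "\<And>i s. i < n \<Longrightarrow> s < d \<Longrightarrow> 0 \<le> X i s"
    and Y_range: "\<And>i. i < n \<Longrightarrow> Y i < K"
    and p_gt: "1 < pw" "1 < pv" "1 < pu"
    and rho_gt: "0 < \<rho>w" "0 < \<rho>v" "0 < \<rho>u" and eps_gt: "0 < \<epsilon>"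
    and alpha: "\<And>m. m < n1 \<Longrightarrow> 1 \<le> \<alpha> m" and beta: "\<And>l. l < n2 \<Longrightarrow> 1 \<le> \<beta> l"
begin

definition I :: "idx set" where
  "I = (\<lambda>(r, l). W r l) ` ({..<K} \<times> {..<n2}) \<union> (\<lambda>(l, m). V l m) ` ({..<n2} \<times> {..<n1})
     \<union> (\<lambda>(m, s). U m s) ` ({..<n1} \<times> {..<d})"

lemma I_iff [simp]:
  "W r l \<in> I \<longleftrightarrow> r < K \<and> l < n2" "V l m \<in> I \<longleftrightarrow> l < n2 \<and> m < n1" "U m s \<in> I \<longleftrightarrow> m < n1 \<and> s < d"
  by (auto simp: I_def)

lemma finite_I: "finite I"
  by (simp add: I_def)

lemma sum_I:
  fixes \<phi> :: "idx \<Rightarrow> real"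
  shows "(\<Sum>i\<in>I. \<phi> i) = (\<Sum>r<K. \<Sum>l<n2. \<phi> (W r l)) + (\<Sum>l<n2. \<Sum>m<n1. \<phi> (V l m)) + (\<Sum>m<n1. \<Sum>s<d. \<phi> (U m s))"
proof -
  have inj: "inj_on (\<lambda>(r, l). W r l) A" "inj_on (\<lambda>(l, m). V l m) A" "inj_on (\<lambda>(m, s). U m s) A" for A
    by (auto simp: inj_on_def)
  show ?thesis unfolding I_def
    by (subst sum.union_disjoint, simp, simp, force)+
       (simp only: sum.reindex[OF inj(1)] sum.reindex[OF inj(2)] sum.reindex[OF inj(3)],
        simp add: sum.cartesian_product case_prod_beta o_def)
qed

definition h1 :: "(idx \<Rightarrow> real) \<Rightarrow> nat \<Rightarrow> nat \<Rightarrow> real" where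
  "h1 z i m = (\<Sum>s<d. z (U m s) * X i s)"

definition h2 :: "(idx \<Rightarrow> real) \<Rightarrow> nat \<Rightarrow> nat \<Rightarrow> real" where
  "h2 z i l = (\<Sum>m<n1. z (V l m) * h1 z i m powr \<alpha> m)"

definition f :: "(idx \<Rightarrow> real) \<Rightarrow> nat \<Rightarrow> nat \<Rightarrow> real" where
  "f z i r = (\<Sum>l<n2. z (W r l) * h2 z i l powr \<beta> l)"

definition F :: "(idx \<Rightarrow> real) \<Rightarrow> real" where
  "F z = Phi n K n2 n1 d \<alpha> \<beta> \<epsilon> X Y (unflat z)"

lemma F_eq: "F z = 1 / real n * (\<Sum>i<n. - ce_loss K (Y i) (f z i) + (\<Sum>r<K. f z i r)) + \<epsilon> * (\<Sum>i\<in>I. z i)"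
proof -
  have "net_f n2 n1 d \<alpha> \<beta> (unflat z) (X i) = f z i" for i
    by (simp add: fun_eq_iff net_f_def f_def h2_def h1_def unflat_def)
  then show ?thesis unfolding F_def Phi_def sum_I by (simp add: unflat_def)
qed

lemma n_pos: "0 < real n" using sizes by simp

lemma K_pos: "0 < K" using sizes Y_range[of 0] by simp

lemma h1_nonneg: "i < n \<Longrightarrow> \<forall>i. 0 \<le> z i \<Longrightarrow> 0 \<le> h1 z i m"
  using X_nonneg by (auto simp: h1_def intro!: sum_nonneg)

lemma h2_nonneg: "\<forall>i. 0 \<le> z i \<Longrightarrow> 0 \<le> h2 z i l"
  by (auto simp: h2_def intro!: sum_nonneg)

section \<open>Constants of the theorem and bounds on the layers\<close>

definition \<theta> :: real where
  "\<theta> = \<rho>v * PsiFun n1 \<alpha> (conj_exp pv) pu (\<lambda>_. 1)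
          (\<rho>u * Max ((\<lambda>i. pnorm (conj_exp pu) {..<d} (X i)) ` {..<n}))"

definition Cw :: real where "Cw = \<rho>w * PsiFun n2 \<beta> (conj_exp pw) pv (\<lambda>_. 1) \<theta>"
definition Cv :: real where "Cv = \<rho>w * PsiFun n2 \<beta> (conj_exp pw) pv \<beta> \<theta>"
definition na :: real where "na = supnorm_vec n1 \<alpha>"
definition nb :: real where "nb = supnorm_vec n2 \<beta>"

lemma PsiFun_nonneg: "0 \<le> PsiFun r \<gamma> p q \<delta> t"
  by (simp add: PsiFun_def Let_def)

lemma theta_nonneg: "0 \<le> \<theta>" and Cw_nonneg: "0 \<le> Cw" and Cv_nonneg: "0 \<le> Cv"
  using rho_gt by (auto simp: \<theta>_def Cw_def Cv_def PsiFun_nonneg)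

lemma alpha_le: "m < n1 \<Longrightarrow> \<alpha> m \<le> na"
proof -
  assume "m < n1"
  then have "\<bar>\<alpha> m\<bar> \<le> na" unfolding na_def supnorm_vec_def by (intro Max_ge) auto
  then show "\<alpha> m \<le> na" by simp
qed

lemma beta_le: "l < n2 \<Longrightarrow> \<beta> l \<le> nb"
proof -
  assume "l < n2"
  then have "\<bar>\<beta> l\<bar> \<le> nb" unfolding nb_def supnorm_vec_def by (intro Max_ge) auto
  then show "\<beta> l \<le> nb" by simp
qed

lemma alpha_pos: "m < n1 \<Longrightarrow> 0 < \<alpha> m" and beta_pos: "l < n2 \<Longrightarrow> 0 < \<beta> l"
  using alpha[of m] beta[of l] by auto

lemma na_ge_1: "1 \<le> na" and nb_ge_1: "1 \<le> nb"
  using alpha[of 0] alpha_le[of 0] beta[of 0] beta_le[of 0] sizes by auto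

definition sphere :: "(idx \<Rightarrow> real) \<Rightarrow> bool" where
  "sphere z \<longleftrightarrow> (\<forall>i. 0 \<le> z i) \<and> (\<forall>r<K. pnorm pw {..<n2} (\<lambda>l. z (W r l)) = \<rho>w)
     \<and> mnorm pv n2 n1 (\<lambda>l m. z (V l m)) = \<rho>v \<and> mnorm pu n1 d (\<lambda>m s. z (U m s)) = \<rho>u"

text \<open>The share of row \<open>l\<close> in the norm of v is kept instead of being bounded by
  1, because these shares are the unit vector used for the next layer.\<close>

lemma h2_le:
  assumes z: "sphere z" and i: "i < n"
  shows "h2 z i l \<le> pnorm pv {..<n1} (\<lambda>m. z (V l m)) / \<rho>v * \<theta>"
proof -
  define \<rho>x where "\<rho>x = Max ((\<lambda>i. pnorm (conj_exp pu) {..<d} (X i)) ` {..<n})"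
  define a where "a m = pnorm pu {..<d} (\<lambda>s. z (U m s)) / \<rho>u" for m
  have zn: "\<forall>i. 0 \<le> z i" using z by (simp add: sphere_def)
  have x: "pnorm (conj_exp pu) {..<d} (X i) \<le> \<rho>x" unfolding \<rho>x_def using i by (intro Max_ge) auto
  then have rx: "0 \<le> \<rho>x" using pnorm_nonneg order_trans by blast
  have h: "h1 z i m \<le> a m * (\<rho>u * \<rho>x)" for m
  proof -
    have "h1 z i m \<le> pnorm pu {..<d} (\<lambda>s. z (U m s)) * pnorm (conj_exp pu) {..<d} (X i)"
      unfolding h1_def using conj_exp_props[OF p_gt(3)] p_gt zn X_nonneg[OF i]
      by (intro Hoelder_sum) auto
    also have "\<dots> \<le> pnorm pu {..<d} (\<lambda>s. z (U m s)) * \<rho>x"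
      using x pnorm_nonneg by (rule mult_left_mono)
    finally show ?thesis using rho_gt by (simp add: a_def)
  qed
  have "h2 z i l = (\<Sum>m<n1. z (V l m) * (1 * h1 z i m powr \<alpha> m))" by (simp add: h2_def)
  also have "\<dots> \<le> pnorm pv {..<n1} (\<lambda>m. z (V l m)) * PsiFun n1 \<alpha> (conj_exp pv) pu (\<lambda>_. 1) (\<rho>u * \<rho>x)"
  proof (rule layer_bound[where a=a])
    show "(\<Sum>m<n1. a m powr pu) \<le> 1"
      unfolding a_def using z rho_gt p_gt sum_row_pnorms[of pu n1 d "\<lambda>m s. z (U m s)" \<rho>u]
      by (simp add: sphere_def)
    show "0 \<le> a m" for m unfolding a_def using rho_gt by simp
  qed (use p_gt alpha rx rho_gt zn h h1_nonneg[OF i zn] in auto)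
  finally show ?thesis using rho_gt by (simp add: \<theta>_def \<rho>x_def[symmetric])
qed

text \<open>Both \<open>Cw\<close> and \<open>Cv\<close> are instances: the first for weights 1, the
  second for weights \<open>\<beta> l\<close>, which appear when the inner layer is
  rescaled.\<close>

lemma weighted_f_le:
  assumes z: "sphere z" and i: "i < n" "r < K" and \<delta>: "\<And>l. l < n2 \<Longrightarrow> 0 \<le> \<delta> l"
  shows "(\<Sum>l<n2. z (W r l) * (\<delta> l * h2 z i l powr \<beta> l)) \<le> \<rho>w * PsiFun n2 \<beta> (conj_exp pw) pv \<delta> \<theta>"
proof -
  define a where "a l = pnorm pv {..<n1} (\<lambda>m. z (V l m)) / \<rho>v" for l
  have zn: "\<forall>i. 0 \<le> z i" using z by (simp add: sphere_def)
  have "(\<Sum>l<n2. z (W r l) * (\<delta> l * h2 z i l powr \<beta> l))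
      \<le> pnorm pw {..<n2} (\<lambda>l. z (W r l)) * PsiFun n2 \<beta> (conj_exp pw) pv \<delta> \<theta>"
  proof (rule layer_bound[where a=a])
    show "(\<Sum>m<n2. a m powr pv) \<le> 1"
      unfolding a_def using z rho_gt p_gt sum_row_pnorms[of pv n2 n1 "\<lambda>m s. z (V m s)" \<rho>v]
      by (simp add: sphere_def)
    show "0 \<le> a m" for m unfolding a_def using rho_gt by simp
  qed (use p_gt beta theta_nonneg \<delta> zn h2_nonneg[OF zn] h2_le[OF z i(1)] in \<open>auto simp: a_def\<close>)
  then show ?thesis using z i by (simp add: sphere_def)
qed

text \<open>One exponent per matrix, so all rows of w share \<open>\<mu>w\<close>. One direction
  suffices for relative bounds since the network is monotone; absolute differences use the relation
  both ways.\<close>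

definition dominated :: "real \<Rightarrow> real \<Rightarrow> real \<Rightarrow> (idx \<Rightarrow> real) \<Rightarrow> (idx \<Rightarrow> real) \<Rightarrow> bool" where
  "dominated \<mu>w \<mu>v \<mu>u z z' \<longleftrightarrow> (\<forall>r<K. \<forall>l<n2. z (W r l) \<le> exp \<mu>w * z' (W r l))
     \<and> (\<forall>l<n2. \<forall>m<n1. z (V l m) \<le> exp \<mu>v * z' (V l m))
     \<and> (\<forall>m<n1. \<forall>s<d. z (U m s) \<le> exp \<mu>u * z' (U m s))"

context
  fixes z z' \<mu>w \<mu>v \<mu>u
  assumes zn: "\<forall>i. 0 \<le> z i" "\<forall>i. 0 \<le> z' i" and mu: "0 \<le> \<mu>w" "0 \<le> \<mu>v" "0 \<le> \<mu>u"
    and dom: "dominated \<mu>w \<mu>v \<mu>u z z'"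
begin

lemma dominatedD:
  "r < K \<Longrightarrow> l < n2 \<Longrightarrow> z (W r l) \<le> exp \<mu>w * z' (W r l)"
  "l < n2 \<Longrightarrow> m < n1 \<Longrightarrow> z (V l m) \<le> exp \<mu>v * z' (V l m)"
  "m < n1 \<Longrightarrow> s < d \<Longrightarrow> z (U m s) \<le> exp \<mu>u * z' (U m s)"
  using dom by (simp_all add: dominated_def)

lemma h1_ratio:
  assumes "i < n" "m < n1"
  shows "h1 z i m \<le> exp \<mu>u * h1 z' i m"
  unfolding h1_def
proof (rule sum_le_exp_mult)
  fix s assume s: "s \<in> {..<d}"
  have "z (U m s) * X i s \<le> (exp \<mu>u * z' (U m s)) * X i s"
    using assms s X_nonneg by (intro mult_right_mono dominatedD) auto
  then show "z (U m s) * X i s \<le> exp \<mu>u * (z' (U m s) * X i s)" by simp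
qed

lemma h2_ratio:
  assumes "i < n" "l < n2"
  shows "h2 z i l \<le> exp (\<mu>v + na * \<mu>u) * h2 z' i l"
  unfolding h2_def
proof (rule sum_le_exp_mult)
  fix m assume "m \<in> {..<n1}"
  then have m: "m < n1" by simp
  have "z (V l m) * h1 z i m powr \<alpha> m \<le> exp (\<mu>v + \<alpha> m * \<mu>u) * (z' (V l m) * h1 z' i m powr \<alpha> m)"
    by (rule mult_le_exp_mult[OF dominatedD(2)[OF assms(2) m] powr_le_exp_mult[OF
        h1_nonneg[OF assms(1) zn(1)] h1_nonneg[OF assms(1) zn(2)] h1_ratio[OF assms(1) m]]])
      (use zn alpha_pos[OF m] in auto)
  also have "\<dots> \<le> exp (\<mu>v + na * \<mu>u) * (z' (V l m) * h1 z' i m powr \<alpha> m)"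
    using mu zn alpha_le[OF m] by (intro mult_right_mono) (auto intro: mult_right_mono)
  finally show "z (V l m) * h1 z i m powr \<alpha> m \<le> exp (\<mu>v + na * \<mu>u) * (z' (V l m) * h1 z' i m powr \<alpha> m)" .
qed

lemma f_term_ratio:
  assumes "i < n" "r < K" "l < n2"
  shows "z (W r l) * h2 z i l powr \<beta> l \<le> exp (\<mu>w + \<beta> l * (\<mu>v + na * \<mu>u)) * (z' (W r l) * h2 z' i l powr \<beta> l)"
  by (rule mult_le_exp_mult[OF dominatedD(1)[OF assms(2,3)] powr_le_exp_mult[OF
        h2_nonneg[OF zn(1)] h2_nonneg[OF zn(2)] h2_ratio[OF assms(1,3)]]])
     (use zn beta_pos[OF assms(3)] in auto)

text \<open>The exponent of each term involves \<open>\<beta> l\<close>. Keeping it inside the sum,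
  rather than bounding it by \<open>nb\<close>, is what leads to \<open>Cv\<close>; u acts through
  the inner power and therefore costs a further factor \<open>na\<close>.\<close>

lemma f_diff_le:
  assumes z: "sphere z" and i: "i < n" "r < K"
  shows "f z i r - f z' i r \<le> Cw * \<mu>w + Cv * \<mu>v + na * Cv * \<mu>u"
proof -
  have "f z i r - f z' i r \<le> (\<Sum>l<n2. (\<mu>w + \<beta> l * (\<mu>v + na * \<mu>u)) * (z (W r l) * h2 z i l powr \<beta> l))"
    unfolding f_def sum_subtractf[symmetric]
    using f_term_ratio[OF i] zn by (intro sum_mono diff_le_of_le_exp_mult) auto
  also have "\<dots> = \<mu>w * (\<Sum>l<n2. z (W r l) * (1 * h2 z i l powr \<beta> l))
      + (\<mu>v + na * \<mu>u) * (\<Sum>l<n2. z (W r l) * (\<beta> l * h2 z i l powr \<beta> l))"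
    unfolding sum_distrib_left sum.distrib[symmetric] by (intro sum.cong refl) (simp add: algebra_simps)
  also have "\<dots> \<le> \<mu>w * Cw + (\<mu>v + na * \<mu>u) * Cv"
  proof (intro add_mono mult_left_mono)
    show "(\<Sum>l<n2. z (W r l) * (1 * h2 z i l powr \<beta> l)) \<le> Cw"
      unfolding Cw_def by (rule weighted_f_le[OF z i]) simp
    show "(\<Sum>l<n2. z (W r l) * (\<beta> l * h2 z i l powr \<beta> l)) \<le> Cv"
      unfolding Cv_def by (rule weighted_f_le[OF z i]) (simp add: beta_pos less_imp_le)
    show "0 \<le> \<mu>w" "0 \<le> \<mu>v + na * \<mu>u" using mu na_ge_1 by simp_all
  qed
  finally show ?thesis by (simp add: algebra_simps)
qed

end

lemma f_mono:
  assumes "\<forall>i. 0 \<le> z i" "\<And>i. z i \<le> z' i" "i < n" "r < K"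
  shows "f z i r \<le> f z' i r"
proof -
  have "\<forall>i. 0 \<le> z' i" using assms(1,2) order_trans by blast
  then show ?thesis
    \<comment> \<open>Monotonicity is domination with all exponents 0.\<close>
    unfolding f_def using f_term_ratio[of z z' 0 0 0 i r] assms
    by (intro sum_mono) (auto simp: dominated_def)
qed

section \<open>Increments and continuity of the objective\<close>

lemma F_gain:
  assumes z: "\<forall>i. 0 \<le> z i" and j: "j \<in> I" and t: "0 \<le> t"
  shows "F z + \<epsilon> * t \<le> F (z(j := z j + t))"
proof -
  let ?z = "z(j := z j + t)"
  have "(\<Sum>i\<in>I. ?z i) = z j + t + (\<Sum>i\<in>I - {j}. ?z i)" using finite_I j by (simp add: sum.remove)
  also have "(\<Sum>i\<in>I - {j}. ?z i) = (\<Sum>i\<in>I - {j}. z i)" by (intro sum.cong) auto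
  finally have "(\<Sum>i\<in>I. ?z i) = (\<Sum>i\<in>I. z i) + t" using finite_I j by (simp add: sum.remove)
  moreover have "(\<Sum>i<n. - ce_loss K (Y i) (f z i) + (\<Sum>r<K. f z i r))
      \<le> (\<Sum>i<n. - ce_loss K (Y i) (f ?z i) + (\<Sum>r<K. f ?z i r))"
    using z t by (intro sum_mono neg_ce_loss_diff_le(2) f_mono Y_range) auto
  ultimately show ?thesis using n_pos by (simp add: F_eq distrib_left divide_right_mono)
qed

text \<open>Shrinking one coordinate by \<open>s\<close> is a case of domination with exponent
  \<open>- ln s\<close> for every matrix, so the output estimate applies even at points with zero
  entries.\<close>

lemma F_loss:
  assumes z: "sphere z" and j: "j \<in> I"
  shows "\<exists>C. \<forall>s\<in>{1/2..1}. F z - F (z(j := s * z j)) \<le> C * (1 - s)"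
proof -
  define D where "D = Cw + Cv + na * Cv"
  have D: "0 \<le> D" using Cw_nonneg Cv_nonneg na_ge_1 by (simp add: D_def)
  have zn: "\<forall>i. 0 \<le> z i" using z by (simp add: sphere_def)
  \<comment> \<open>In the constant, one factor 2 comes from the loss and one from
    \<open>- ln s \<le> 2 * (1 - s)\<close>; \<open>K\<close> counts the outputs, and the last
    summand is the linear term of the objective.\<close>
  have "F z - F (z(j := s * z j)) \<le> (4 * K * D + \<epsilon> * z j) * (1 - s)" if s: "s \<in> {1/2..1}" for s
  proof -
    let ?z = "z(j := s * z j)"
    have zn': "\<forall>i. 0 \<le> ?z i" using zn s by simp
    have le: "?z i \<le> z i" for i using zn s by (auto intro: mult_left_le_one_le)
    have mu: "0 \<le> - ln s" using s by (simp add: ln_le_zero_iff)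
    have "z i \<le> exp (- ln s) * ?z i" for i
    proof (cases "i = j")
      case False
      have "1 * z i \<le> exp (- ln s) * z i" using mu zn by (intro mult_right_mono) auto
      with False show ?thesis by simp
    qed (use s in \<open>simp add: exp_minus divide_simps\<close>)
    then have dom: "dominated (- ln s) (- ln s) (- ln s) z ?z" by (simp only: dominated_def) blast
    have "- ln s = ln (1 / s)" using s by (simp add: ln_div)
    also have "\<dots> \<le> 1 / s - 1" using s by (intro ln_le_minus_one) auto
    \<comment> \<open>\<open>1 / s - 1 = (1 - s) / s\<close>, and \<open>s\<close> is at least one
      half.\<close>
    also have "\<dots> \<le> 2 * (1 - s)"
    proof -
      have "0 \<le> (2 * s - 1) * (1 - s)" using s by (intro mult_nonneg_nonneg) auto
      then show ?thesis using s by (simp add: field_simps)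
    qed
    finally have ln_s: "- ln s \<le> 2 * (1 - s)" .
    have diff: "f z i r - f ?z i r \<le> D * (2 * (1 - s))" if "i < n" "r < K" for i r
    proof -
      have "f z i r - f ?z i r \<le> D * (- ln s)"
        using f_diff_le[OF zn zn' mu mu mu dom z that] by (simp add: D_def algebra_simps)
      also have "\<dots> \<le> D * (2 * (1 - s))" using ln_s D by (rule mult_left_mono)
      finally show ?thesis .
    qed
    have "(\<Sum>i<n. - ce_loss K (Y i) (f z i) + (\<Sum>r<K. f z i r))
        - (\<Sum>i<n. - ce_loss K (Y i) (f ?z i) + (\<Sum>r<K. f ?z i r))
      \<le> (\<Sum>i<n. 2 * (\<Sum>r<K. D * (2 * (1 - s))))"
      unfolding sum_subtractf[symmetric]
    proof (rule sum_mono)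
      fix i assume "i \<in> {..<n}"
      then have i: "i < n" by simp
      have "2 * (\<Sum>r<K. f z i r - f ?z i r) \<le> 2 * (\<Sum>r<K. D * (2 * (1 - s)))"
        using diff[OF i] by (intro mult_left_mono sum_mono) auto
      then show "- ce_loss K (Y i) (f z i) + (\<Sum>r<K. f z i r) - (- ce_loss K (Y i) (f ?z i) + (\<Sum>r<K. f ?z i r))
          \<le> 2 * (\<Sum>r<K. D * (2 * (1 - s)))"
        using neg_ce_loss_diff_le(1)[of "Y i" K "f ?z i" "f z i", OF Y_range[OF i] f_mono[OF zn' le i]]
        by linarith
    qed
    then have "1 / n * (\<Sum>i<n. - ce_loss K (Y i) (f z i) + (\<Sum>r<K. f z i r))
        - 1 / n * (\<Sum>i<n. - ce_loss K (Y i) (f ?z i) + (\<Sum>r<K. f ?z i r)) \<le> 4 * K * D * (1 - s)"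
      using n_pos by (simp add: field_simps)
    moreover have "(\<Sum>i\<in>I. ?z i) = s * z j + (\<Sum>i\<in>I - {j}. ?z i)" using finite_I j by (simp add: sum.remove)
    moreover have "(\<Sum>i\<in>I - {j}. ?z i) = (\<Sum>i\<in>I - {j}. z i)" by (intro sum.cong) auto
    moreover have "(\<Sum>i\<in>I. z i) = z j + (\<Sum>i\<in>I - {j}. z i)" using finite_I j by (simp add: sum.remove)
    ultimately show ?thesis unfolding F_eq by (simp add: algebra_simps)
  qed
  then show ?thesis by blast
qed

text \<open>Zero entries are included: on nonnegative bases \<open>powr\<close> is continuous up to
  0 because the exponents are positive.\<close>

lemma continuous_on_F: "continuous_on {z. \<forall>i. 0 \<le> z i} F"
proof -
  let ?P = "{z :: idx \<Rightarrow> real. \<forall>i. 0 \<le> z i}"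
  have coord: "continuous_on ?P (\<lambda>z. z i)" for i
    by (rule continuous_on_subset[OF continuous_on_product_coordinates]) simp
  have c1: "continuous_on ?P (\<lambda>z. h1 z i m)" for i m
    unfolding h1_def by (intro continuous_intros coord)
  have c2: "continuous_on ?P (\<lambda>z. h2 z i l)" if "i < n" for i l
    unfolding h2_def using alpha_pos h1_nonneg[OF that]
    by (intro continuous_on_sum continuous_on_mult coord continuous_on_powr' c1 continuous_on_const) auto
  have c3: "continuous_on ?P (\<lambda>z. f z i r)" if "i < n" for i r
    unfolding f_def using beta_pos h2_nonneg
    by (intro continuous_on_sum continuous_on_mult coord continuous_on_powr' c2[OF that] continuous_on_const) auto
  have "0 < (\<Sum>j<K. exp (f z i j))" for z i using K_pos by (intro sum_pos) auto
  then have "(\<Sum>j<K. exp (f z i j)) \<noteq> 0" for z i by (metis less_irrefl)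
  then show ?thesis unfolding F_eq ce_loss_def
    by (intro continuous_intros coord c3 Y_range) auto
qed

section \<open>The gradient and its relative variation\<close>

definition coef :: "(idx \<Rightarrow> real) \<Rightarrow> nat \<Rightarrow> nat \<Rightarrow> real" where
  "coef z i r = loss_coeff K (Y i) (f z i) r"

text \<open>The gradient in closed form, valid at positive parameters. The products are bracketed as
  in \<open>collect_chain_rule\<close>, which also lets \<open>mult_le_exp_mult\<close> be applied
  factor by factor.\<close>

primrec grad :: "(idx \<Rightarrow> real) \<Rightarrow> idx \<Rightarrow> real" where
  "grad z (W r l) = 1 / n * (\<Sum>i<n. coef z i r * h2 z i l powr \<beta> l) + \<epsilon>"
| "grad z (V l m) = 1 / n * (\<Sum>i<n. \<Sum>r<K. coef z i r *
     (z (W r l) * ((\<beta> l * h2 z i l powr (\<beta> l - 1)) * h1 z i m powr \<alpha> m))) + \<epsilon>"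
| "grad z (U m s) = 1 / n * (\<Sum>i<n. \<Sum>r<K. coef z i r * (\<Sum>l<n2.
     z (W r l) * ((\<beta> l * h2 z i l powr (\<beta> l - 1)) * (z (V l m) * ((\<alpha> m * h1 z i m powr (\<alpha> m - 1)) * X i s))))) + \<epsilon>"

lemma coef_nonneg: "r < K \<Longrightarrow> 0 \<le> coef z i r"
  unfolding coef_def by (rule loss_coeff_nonneg)

lemma grad_pos:
  assumes "\<forall>i. 0 \<le> z i" "j \<in> I"
  shows "0 < grad z j"
proof -
  have pos: "0 < 1 / n * x + \<epsilon>" if "0 \<le> x" for x :: real
  proof -
    have "0 \<le> 1 / n * x" using that by simp
    then show ?thesis using eps_gt by linarith
  qed
  show ?thesis
  proof (cases j)
    case (W r l)
    show ?thesis unfolding W grad.simps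
      using W assms coef_nonneg by (intro pos sum_nonneg mult_nonneg_nonneg) auto
  next
    case (V l m)
    show ?thesis unfolding V grad.simps
      using V assms coef_nonneg beta_pos[of l] by (intro pos sum_nonneg mult_nonneg_nonneg) auto
  next
    case (U m s)
    show ?thesis unfolding U grad.simps
      using U assms coef_nonneg alpha_pos[of m] beta_pos X_nonneg
      by (intro pos sum_nonneg mult_nonneg_nonneg) (auto intro: less_imp_le)
  qed
qed

text \<open>A derivative weight depends on all outputs, some raising and some lowering it, so the
  outputs must be controlled on both sides; hence domination in both directions.\<close>

lemma coef_ratio:
  assumes z: "sphere z" "sphere z'" and mu: "0 \<le> \<mu>w" "0 \<le> \<mu>v" "0 \<le> \<mu>u"
    and dom: "dominated \<mu>w \<mu>v \<mu>u z z'" "dominated \<mu>w \<mu>v \<mu>u z' z" and i: "i < n" "r < K"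
  shows "coef z i r \<le> exp (2 * (Cw * \<mu>w + Cv * \<mu>v + na * Cv * \<mu>u)) * coef z' i r"
proof -
  have zn: "\<forall>i. 0 \<le> z i" "\<forall>i. 0 \<le> z' i" using z by (auto simp: sphere_def)
  show ?thesis unfolding coef_def
  proof (rule loss_coeff_le[OF i(2)])
    fix j assume j: "j < K"
    show "\<bar>f z i j - f z' i j\<bar> \<le> Cw * \<mu>w + Cv * \<mu>v + na * Cv * \<mu>u"
      using f_diff_le[OF zn mu dom(1) z(1) i(1) j] f_diff_le[OF zn(2,1) mu dom(2) z(2) i(1) j] by linarith
  qed
qed

text \<open>The constant \<epsilon> obeys any relative bound with factor at least 1.\<close>

lemma average_ratio:
  assumes "S \<le> exp L * S'" "0 \<le> L"
  shows "1 / n * S + \<epsilon> \<le> exp L * (1 / n * S' + \<epsilon>)"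
proof -
  have "1 * \<epsilon> \<le> exp L * \<epsilon>" using assms(2) eps_gt by (intro mult_right_mono) auto
  moreover have "1 / n * S \<le> 1 / n * (exp L * S')" using assms(1) by (intro mult_left_mono) auto
  ultimately show ?thesis by (simp add: distrib_left)
qed

context
  fixes z z' \<mu>w \<mu>v \<mu>u
  assumes z: "sphere z" "sphere z'" and mu: "0 \<le> \<mu>w" "0 \<le> \<mu>v" "0 \<le> \<mu>u"
    and dom: "dominated \<mu>w \<mu>v \<mu>u z z'" "dominated \<mu>w \<mu>v \<mu>u z' z"
begin

private lemma zn: "\<forall>i. 0 \<le> z i" "\<forall>i. 0 \<le> z' i"
  using z by (auto simp: sphere_def)

private lemma D_nonneg: "0 \<le> 2 * (Cw * \<mu>w + Cv * \<mu>v + na * Cv * \<mu>u)"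
  using Cw_nonneg Cv_nonneg na_ge_1 mu by simp

private lemma na_mu: "0 \<le> na * \<mu>u"
  using na_ge_1 mu by simp

private lemma outer_deriv_ratio:
  assumes "i < n" "l < n2"
  shows "\<beta> l * h2 z i l powr (\<beta> l - 1)
    \<le> exp ((\<beta> l - 1) * (\<mu>v + na * \<mu>u)) * (\<beta> l * h2 z' i l powr (\<beta> l - 1))"
proof -
  have "h2 z i l powr (\<beta> l - 1) \<le> exp ((\<beta> l - 1) * (\<mu>v + na * \<mu>u)) * h2 z' i l powr (\<beta> l - 1)"
    using beta[OF assms(2)] by (intro powr_le_exp_mult h2_nonneg zn h2_ratio[OF zn mu dom(1) assms]) auto
  from mult_left_mono[OF this, of "\<beta> l"] show ?thesis using beta_pos[OF assms(2)]
    by (simp add: mult.left_commute)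
qed

text \<open>The entry has degree 0 in w and carries the full power \<open>\<beta> l\<close> of the
  hidden layer, hence no \<open>+ 1\<close> at \<open>\<mu>w\<close> and no \<open>- 1\<close> at
  \<open>\<mu>v\<close>.\<close>

lemma grad_ratio_W:
  assumes "r < K" "l < n2"
  shows "grad z (W r l) \<le> exp (2 * Cw * \<mu>w + (2 * Cv + nb) * \<mu>v + (2 * (na * Cv) + na * nb) * \<mu>u) * grad z' (W r l)"
  (is "_ \<le> exp ?L * _")
proof -
  have L: "2 * (Cw * \<mu>w + Cv * \<mu>v + na * Cv * \<mu>u) + \<beta> l * (\<mu>v + na * \<mu>u) \<le> ?L"
    using mult_right_mono[OF beta_le[OF assms(2)], of "\<mu>v + na * \<mu>u"] mu na_mu by (simp add: algebra_simps)
  have "0 \<le> \<beta> l * (\<mu>v + na * \<mu>u)" using mu na_mu beta_pos[OF assms(2)] by simp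
  with L have L0: "0 \<le> ?L" using D_nonneg by linarith
  show ?thesis unfolding grad.simps
  proof (rule average_ratio[OF sum_le_exp_mult L0])
    fix i assume "i \<in> {..<n}"
    then have i: "i < n" by simp
    have "coef z i r * h2 z i l powr \<beta> l
      \<le> exp (2 * (Cw * \<mu>w + Cv * \<mu>v + na * Cv * \<mu>u) + \<beta> l * (\<mu>v + na * \<mu>u)) * (coef z' i r * h2 z' i l powr \<beta> l)"
      using beta_pos[OF assms(2)]
      by (intro mult_le_exp_mult coef_ratio[OF z mu dom i assms(1)] powr_le_exp_mult h2_nonneg zn
          h2_ratio[OF zn mu dom(1) i assms(2)] coef_nonneg assms) auto
    then show "coef z i r * h2 z i l powr \<beta> l \<le> exp ?L * (coef z' i r * h2 z' i l powr \<beta> l)"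
      using coef_nonneg assms by (intro le_exp_mult_mono[OF _ L]) auto
  qed
qed

text \<open>The factor w gives the \<open>+ 1\<close>; the power \<open>\<beta> l - 1\<close> gives
  \<open>nb - 1\<close> at \<open>\<mu>v\<close> and \<open>na * (nb - 1)\<close> at
  \<open>\<mu>u\<close>, which the inner power completes to \<open>na * nb\<close>.\<close>

lemma grad_ratio_V:
  assumes "l < n2" "m < n1"
  shows "grad z (V l m)
    \<le> exp ((2 * Cw + 1) * \<mu>w + (2 * Cv + nb - 1) * \<mu>v + (2 * (na * Cv) + na * nb) * \<mu>u) * grad z' (V l m)"
  (is "_ \<le> exp ?L * _")
proof -
  define e where "e = \<mu>w + ((\<beta> l - 1) * (\<mu>v + na * \<mu>u) + \<alpha> m * \<mu>u)"
  have "(\<beta> l - 1) * (\<mu>v + na * \<mu>u) \<le> (nb - 1) * (\<mu>v + na * \<mu>u)"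
    using beta_le[OF assms(1)] mu na_mu by (intro mult_right_mono) auto
  moreover have "\<alpha> m * \<mu>u \<le> na * \<mu>u" using alpha_le[OF assms(2)] mu by (intro mult_right_mono) auto
  ultimately have L: "2 * (Cw * \<mu>w + Cv * \<mu>v + na * Cv * \<mu>u) + e \<le> ?L"
    by (simp add: e_def algebra_simps)
  have "0 \<le> e" using mu na_mu beta[OF assms(1)] alpha_pos[OF assms(2)] by (simp add: e_def)
  with L have L0: "0 \<le> ?L" using D_nonneg by linarith
  show ?thesis unfolding grad.simps
  proof (rule average_ratio[OF sum_le_exp_mult[OF sum_le_exp_mult] L0])
    fix i r assume "i \<in> {..<n}" "r \<in> {..<K}"
    then have i: "i < n" "r < K" by auto
    let ?t = "\<lambda>z. z (W r l) * ((\<beta> l * h2 z i l powr (\<beta> l - 1)) * h1 z i m powr \<alpha> m)"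
    have bn: "0 \<le> \<beta> l" using beta_pos[OF assms(1)] by simp
    have tn: "0 \<le> ?t z" "0 \<le> ?t z'" using zn bn by simp_all
    have "?t z \<le> exp e * ?t z'" unfolding e_def
      using alpha_pos[OF assms(2)] bn zn
      by (intro mult_le_exp_mult dominatedD[OF zn mu dom(1)] outer_deriv_ratio powr_le_exp_mult
          h1_nonneg h1_ratio[OF zn mu dom(1)] assms i) auto
    then have "coef z i r * ?t z \<le> exp (2 * (Cw * \<mu>w + Cv * \<mu>v + na * Cv * \<mu>u) + e) * (coef z' i r * ?t z')"
      using tn by (intro mult_le_exp_mult coef_ratio[OF z mu dom i] coef_nonneg i) auto
    then show "coef z i r * ?t z \<le> exp ?L * (coef z' i r * ?t z')"
      using tn coef_nonneg[OF i(2)] by (intro le_exp_mult_mono[OF _ L]) auto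
  qed
qed

text \<open>Compared with v, the extra factor v restores \<open>nb\<close> at \<open>\<mu>v\<close>,
  and the inner power drops to \<open>\<alpha> m - 1\<close>, leaving
  \<open>na * (nb - 1) + (na - 1) = na * nb - 1\<close> at \<open>\<mu>u\<close>.\<close>

lemma grad_ratio_U:
  assumes "m < n1" "s < d"
  shows "grad z (U m s)
    \<le> exp ((2 * Cw + 1) * \<mu>w + (2 * Cv + nb) * \<mu>v + (2 * (na * Cv) + na * nb - 1) * \<mu>u) * grad z' (U m s)"
  (is "_ \<le> exp ?L * _")
proof -
  define E where "E = \<mu>w + ((nb - 1) * (\<mu>v + na * \<mu>u) + (\<mu>v + (na - 1) * \<mu>u))"
  have L: "2 * (Cw * \<mu>w + Cv * \<mu>v + na * Cv * \<mu>u) + E \<le> ?L"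
    by (simp add: E_def algebra_simps)
  have "0 \<le> E" using mu na_mu na_ge_1 nb_ge_1 by (simp add: E_def)
  with L have L0: "0 \<le> ?L" using D_nonneg by linarith
  show ?thesis unfolding grad.simps
  proof (rule average_ratio[OF sum_le_exp_mult[OF sum_le_exp_mult] L0])
    fix i r assume "i \<in> {..<n}" "r \<in> {..<K}"
    then have i: "i < n" "r < K" by auto
    let ?t = "\<lambda>z l. z (W r l) * ((\<beta> l * h2 z i l powr (\<beta> l - 1)) * (z (V l m) * ((\<alpha> m * h1 z i m powr (\<alpha> m - 1)) * X i s)))"
    have an: "0 \<le> \<alpha> m" using alpha_pos[OF assms(1)] by simp
    have bn: "0 \<le> \<beta> l" if "l < n2" for l using beta_pos[OF that] by simp
    have xn: "0 \<le> X i s" using X_nonneg i assms by simp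
    have tn: "0 \<le> ?t z l" "0 \<le> ?t z' l" if "l < n2" for l using zn bn[OF that] an xn by simp_all
    have inner: "(\<alpha> m * h1 z i m powr (\<alpha> m - 1)) * X i s
        \<le> exp ((\<alpha> m - 1) * \<mu>u) * ((\<alpha> m * h1 z' i m powr (\<alpha> m - 1)) * X i s)"
    proof -
      have "h1 z i m powr (\<alpha> m - 1) \<le> exp ((\<alpha> m - 1) * \<mu>u) * h1 z' i m powr (\<alpha> m - 1)"
        using alpha[OF assms(1)] by (intro powr_le_exp_mult h1_nonneg zn h1_ratio[OF zn mu dom(1)] i assms) auto
      from mult_left_mono[OF this, of "\<alpha> m * X i s"] show ?thesis using an xn by (simp add: mult_ac)
    qed
    have "?t z l \<le> exp E * ?t z' l" if l: "l < n2" for l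
    proof -
      have "?t z l \<le> exp (\<mu>w + ((\<beta> l - 1) * (\<mu>v + na * \<mu>u) + (\<mu>v + (\<alpha> m - 1) * \<mu>u))) * ?t z' l"
        using zn an xn bn[OF l]
        by (intro mult_le_exp_mult dominatedD[OF zn mu dom(1)] outer_deriv_ratio inner assms i l) auto
      moreover have "(\<beta> l - 1) * (\<mu>v + na * \<mu>u) \<le> (nb - 1) * (\<mu>v + na * \<mu>u)"
        using beta_le[OF l] mu na_mu by (intro mult_right_mono) auto
      moreover have "(\<alpha> m - 1) * \<mu>u \<le> (na - 1) * \<mu>u" using alpha_le[OF assms(1)] mu by (intro mult_right_mono) auto
      ultimately show ?thesis using tn(2)[OF l] by (elim le_exp_mult_mono) (auto simp: E_def)
    qed
    then have "(\<Sum>l<n2. ?t z l) \<le> exp E * (\<Sum>l<n2. ?t z' l)" by (intro sum_le_exp_mult) auto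
    moreover have sn: "0 \<le> (\<Sum>l<n2. ?t z l)" "0 \<le> (\<Sum>l<n2. ?t z' l)" using tn by (auto intro!: sum_nonneg)
    ultimately have "coef z i r * (\<Sum>l<n2. ?t z l)
        \<le> exp (2 * (Cw * \<mu>w + Cv * \<mu>v + na * Cv * \<mu>u) + E) * (coef z' i r * (\<Sum>l<n2. ?t z' l))"
      by (intro mult_le_exp_mult coef_ratio[OF z mu dom i] coef_nonneg i) auto
    then show "coef z i r * (\<Sum>l<n2. ?t z l) \<le> exp ?L * (coef z' i r * (\<Sum>l<n2. ?t z' l))"
      using sn coef_nonneg[OF i(2)] by (intro le_exp_mult_mono[OF _ L]) auto
  qed
qed

end

section \<open>Differentiation along curves through positive parameters\<close>

lemma f_deriv:
  assumes pos: "\<forall>i\<in>I. 0 < c t i" and dc: "\<forall>i\<in>I. ((\<lambda>s. c s i) has_real_derivative c' i) (at t)"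
    and i: "i < n" "r < K"
  shows "((\<lambda>s. f (c s) i r) has_real_derivative
     (\<Sum>l<n2. c' (W r l) * h2 (c t) i l powr \<beta> l + c t (W r l) * (\<beta> l * h2 (c t) i l powr (\<beta> l - 1) *
       (\<Sum>m<n1. c' (V l m) * h1 (c t) i m powr \<alpha> m + c t (V l m) * (\<alpha> m * h1 (c t) i m powr (\<alpha> m - 1) *
         (\<Sum>s<d. c' (U m s) * X i s)))))) (at t)"
proof -
  \<comment> \<open>A nonzero input makes every hidden unit positive at positive parameters. A zero
    input makes them vanish along the whole curve. In both cases the powers can be
    differentiated.\<close>
  have alt: "(\<forall>m<n1. 0 < h1 (c t) i m) \<or> (\<forall>s. \<forall>m. h1 (c s) i m = 0)"
  proof (cases "\<exists>s<d. X i s \<noteq> 0")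
    case True
    then obtain s where s: "s < d" "0 < X i s" using X_nonneg[OF i(1)] by (metis less_eq_real_def)
    have "0 < h1 (c t) i m" if "m < n1" for m
      unfolding h1_def using s pos that X_nonneg[OF i(1)]
      by (intro sum_pos2[of _ s]) (auto simp: less_imp_le)
    then show ?thesis by blast
  next
    case False
    then have "h1 (c s) i m = 0" for s m by (simp add: h1_def)
    then show ?thesis by blast
  qed
  have alt2: "0 < h2 (c t) i l \<or> (\<forall>s. h2 (c s) i l = 0)" if l: "l < n2" for l
    using alt
  proof
    assume "\<forall>m<n1. 0 < h1 (c t) i m"
    then have "0 < h2 (c t) i l" unfolding h2_def using l pos sizes
      by (intro sum_pos) (auto simp: lessThan_empty_iff)
    then show ?thesis ..
  qed (simp add: h2_def)
  have d1: "((\<lambda>s. h1 (c s) i m) has_real_derivative (\<Sum>s<d. c' (U m s) * X i s)) (at t)" if "m < n1" for m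
    unfolding h1_def using dc that by (intro DERIV_sum DERIV_cmult_right) auto
  have d2: "((\<lambda>s. h2 (c s) i l) has_real_derivative
      (\<Sum>m<n1. c' (V l m) * h1 (c t) i m powr \<alpha> m + c t (V l m) * (\<alpha> m * h1 (c t) i m powr (\<alpha> m - 1) *
         (\<Sum>s<d. c' (U m s) * X i s)))) (at t)" if l: "l < n2" for l
    unfolding h2_def
  proof (rule DERIV_sum)
    fix m assume "m \<in> {..<n1}"
    then have m: "m < n1" by simp
    have "((\<lambda>s. h1 (c s) i m powr \<alpha> m) has_real_derivative
        \<alpha> m * h1 (c t) i m powr (\<alpha> m - 1) * (\<Sum>s<d. c' (U m s) * X i s)) (at t)"
      using alt m by (intro deriv_powr_pos_or_const_0 d1) auto
    from DERIV_mult[OF _ this, of "\<lambda>s. c s (V l m)"] dc l m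
    show "((\<lambda>s. c s (V l m) * h1 (c s) i m powr \<alpha> m) has_real_derivative
        c' (V l m) * h1 (c t) i m powr \<alpha> m + c t (V l m) * (\<alpha> m * h1 (c t) i m powr (\<alpha> m - 1) *
         (\<Sum>s<d. c' (U m s) * X i s))) (at t)"
      by (simp add: mult.commute)
  qed
  show ?thesis
    unfolding f_def
  proof (rule DERIV_sum)
    fix l assume "l \<in> {..<n2}"
    then have l: "l < n2" by simp
    from DERIV_mult[OF _ deriv_powr_pos_or_const_0[OF d2[OF l] alt2[OF l], of "\<beta> l"], of "\<lambda>s. c s (W r l)" "c' (W r l)"] dc l i
    show "((\<lambda>s. c s (W r l) * h2 (c s) i l powr \<beta> l) has_real_derivative
       c' (W r l) * h2 (c t) i l powr \<beta> l + c t (W r l) * (\<beta> l * h2 (c t) i l powr (\<beta> l - 1) *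
       (\<Sum>m<n1. c' (V l m) * h1 (c t) i m powr \<alpha> m + c t (V l m) * (\<alpha> m * h1 (c t) i m powr (\<alpha> m - 1) *
         (\<Sum>s<d. c' (U m s) * X i s))))) (at t)"
      by (simp add: mult.commute)
  qed
qed

lemma F_deriv:
  assumes pos: "\<forall>i\<in>I. 0 < c t i" and dc: "\<forall>i\<in>I. ((\<lambda>s. c s i) has_real_derivative c' i) (at t)"
  shows "((\<lambda>s. F (c s)) has_real_derivative (\<Sum>i\<in>I. grad (c t) i * c' i)) (at t)"
proof -
  define Df where "Df i r = (\<Sum>l<n2. c' (W r l) * h2 (c t) i l powr \<beta> l + c t (W r l) * (\<beta> l * h2 (c t) i l powr (\<beta> l - 1) *
       (\<Sum>m<n1. c' (V l m) * h1 (c t) i m powr \<alpha> m + c t (V l m) * (\<alpha> m * h1 (c t) i m powr (\<alpha> m - 1) *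
         (\<Sum>s<d. c' (U m s) * X i s)))))" for i r
  have "((\<lambda>s. F (c s)) has_real_derivative
      1 / n * (\<Sum>i<n. \<Sum>r<K. coef (c t) i r * Df i r) + \<epsilon> * (\<Sum>i\<in>I. c' i)) (at t)"
    unfolding F_eq coef_def Df_def using dc
    by (intro DERIV_add DERIV_cmult DERIV_sum neg_ce_loss_deriv f_deriv[OF pos dc] Y_range) auto
  moreover have "(\<Sum>i\<in>I. grad (c t) i * c' i)
      = 1 / n * (\<Sum>i<n. \<Sum>r<K. coef (c t) i r * Df i r) + \<epsilon> * (\<Sum>i\<in>I. c' i)"
    unfolding Df_def collect_chain_rule
    unfolding sum_I grad.simps distrib_right distrib_left sum.distrib average_rotate
    by (simp add: sum_distrib_left)
  ultimately show ?thesis by simp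
qed

end

section \<open>Contraction and the maximizer\<close>

lemma pnorm_reindex:
  assumes "inj_on h A"
  shows "pnorm p (h ` A) \<phi> = pnorm p A (\<lambda>x. \<phi> (h x))"
  by (simp add: pnorm_def sum.reindex[OF assms])

lemma flat_tuple:
  "flat (w, v, u) (W i j) = w i j" "flat (w, v, u) (V i j) = v i j" "flat (w, v, u) (U i j) = u i j"
  by (simp_all add: flat_def)

text \<open>One weight per matrix. In the three inequalities w enters once and not \<open>K\<close>
  times: an output reads a single row of w, and all rows share one bound. They are therefore
  inequalities rather than the eigenvalue equations of A.\<close>

locale network_contraction = network +
  fixes bw bv bu lam :: real
  assumes b_gt: "0 < bw" "0 < bv" "0 < bu" and lam_bounds: "0 \<le> lam" "lam < 1"
    and eigen_w: "2 * (conj_exp pw - 1) * (2 * Cw * bw + (2 * Cv + nb) * bv + (2 * (na * Cv) + na * nb) * bu) \<le> lam * bw"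
    and eigen_v: "2 * (conj_exp pv - 1) * ((2 * Cw + 1) * bw + (2 * Cv + nb - 1) * bv + (2 * (na * Cv) + na * nb) * bu) \<le> lam * bv"
    and eigen_u: "2 * (conj_exp pu - 1) * ((2 * Cw + 1) * bw + (2 * Cv + nb) * bv + (2 * (na * Cv) + na * nb - 1) * bu) \<le> lam * bu"
begin

text \<open>The numbering is that of the rows of \<open>A_mat\<close>: each row of w is a block,
  then v, then u.\<close>

primrec blk :: "idx \<Rightarrow> nat" where
  "blk (W r l) = r"
| "blk (V l m) = K"
| "blk (U m s) = Suc K"

definition by_block :: "real \<Rightarrow> real \<Rightarrow> real \<Rightarrow> nat \<Rightarrow> real" where
  "by_block x y z k = (if k < K then x else if k = K then y else z)"

lemma by_block_simps [simp]:
  "k < K \<Longrightarrow> by_block x y z k = x" "by_block x y z K = y" "by_block x y z (Suc K) = z"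
  by (simp_all add: by_block_def)

sublocale ms: multi_sphere I blk "by_block pw pv pu" "by_block \<rho>w \<rho>v \<rho>u" "by_block bw bv bu"
  by unfold_locales (use finite_I p_gt rho_gt b_gt in \<open>auto simp: by_block_def\<close>)

lemma blk_image: "blk ` I = insert K (insert (Suc K) {..<K})"
proof
  show "blk ` I \<subseteq> insert K (insert (Suc K) {..<K})"
  proof
    fix k assume "k \<in> blk ` I"
    then obtain i where "i \<in> I" "k = blk i" by auto
    then show "k \<in> insert K (insert (Suc K) {..<K})" by (cases i) auto
  qed
  have "K = blk (V 0 0)" "Suc K = blk (U 0 0)" "\<And>r. r = blk (W r 0)" by simp_all
  moreover have "V 0 0 \<in> I" "U 0 0 \<in> I" "\<And>r. r < K \<Longrightarrow> W r 0 \<in> I" using sizes by auto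
  ultimately show "insert K (insert (Suc K) {..<K}) \<subseteq> blk ` I"
    by (metis (mono_tags, lifting) image_eqI insert_subset lessThan_iff subsetI)
qed

lemma pnorm_block_W: "r < K \<Longrightarrow> pnorm p (ms.B r) \<phi> = pnorm p {..<n2} (\<lambda>l. \<phi> (W r l))"
proof -
  assume r: "r < K"
  have "ms.B r = W r ` {..<n2}"
  proof (rule Set.set_eqI)
    fix i show "i \<in> ms.B r \<longleftrightarrow> i \<in> W r ` {..<n2}" using r by (cases i) (auto simp: ms.B_def)
  qed
  then show ?thesis by (simp add: pnorm_reindex inj_on_def)
qed

lemma pnorm_block_V: "pnorm p (ms.B K) \<phi> = mnorm p n2 n1 (\<lambda>l m. \<phi> (V l m))"
proof -
  have "ms.B K = (\<lambda>(l, m). V l m) ` ({..<n2} \<times> {..<n1})"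
  proof (rule Set.set_eqI)
    fix i show "i \<in> ms.B K \<longleftrightarrow> i \<in> (\<lambda>(l, m). V l m) ` ({..<n2} \<times> {..<n1})" by (cases i) (auto simp: ms.B_def)
  qed
  moreover have "inj_on (\<lambda>(l, m). V l m) ({..<n2} \<times> {..<n1})" by (auto simp: inj_on_def)
  ultimately show ?thesis by (simp only: pnorm_reindex mnorm_def) (auto intro!: pnorm_cong)
qed

lemma pnorm_block_U: "pnorm p (ms.B (Suc K)) \<phi> = mnorm p n1 d (\<lambda>m s. \<phi> (U m s))"
proof -
  have "ms.B (Suc K) = (\<lambda>(m, s). U m s) ` ({..<n1} \<times> {..<d})"
  proof (rule Set.set_eqI)
    fix i show "i \<in> ms.B (Suc K) \<longleftrightarrow> i \<in> (\<lambda>(m, s). U m s) ` ({..<n1} \<times> {..<d})" by (cases i) (auto simp: ms.B_def)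
  qed
  moreover have "inj_on (\<lambda>(m, s). U m s) ({..<n1} \<times> {..<d})" by (auto simp: inj_on_def)
  ultimately show ?thesis by (simp only: pnorm_reindex mnorm_def) (auto intro!: pnorm_cong)
qed

lemma S_iff: "z \<in> ms.S \<longleftrightarrow> sphere z \<and> (\<forall>i. i \<notin> I \<longrightarrow> z i = 0)"
  unfolding ms.S_def sphere_def blk_image
  by (auto simp: pnorm_block_W pnorm_block_V pnorm_block_U)

lemma close_dominated:
  assumes z: "z \<in> ms.Spos" "z' \<in> ms.Spos" and cl: "ms.close M z z'"
  shows "dominated (M * bw) (M * bv) (M * bu) z z'"
proof -
  have *: "z i \<le> exp (M * by_block bw bv bu (blk i)) * z' i" if i: "i \<in> I" for i
  proof -
    have pos: "0 < z i" "0 < z' i" using z i by (auto simp: ms.Spos_def)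
    have "ln (z i) \<le> M * by_block bw bv bu (blk i) + ln (z' i)"
      using cl i by (auto simp: ms.close_def abs_le_iff)
    then have "exp (ln (z i)) \<le> exp (M * by_block bw bv bu (blk i) + ln (z' i))" by simp
    then show ?thesis using pos by (simp add: exp_add)
  qed
  show ?thesis unfolding dominated_def
  proof (intro conjI allI impI)
    show "z (W r l) \<le> exp (M * bw) * z' (W r l)" if "r < K" "l < n2" for r l using *[of "W r l"] that by simp
    show "z (V l m) \<le> exp (M * bv) * z' (V l m)" if "l < n2" "m < n1" for l m using *[of "V l m"] that by simp
    show "z (U m s) \<le> exp (M * bu) * z' (U m s)" if "m < n1" "s < d" for m s using *[of "U m s"] that by simp
  qed
qed

lemma Spos_nonneg: "z \<in> ms.Spos \<Longrightarrow> \<forall>i. 0 \<le> z i"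
  by (simp add: ms.Spos_def ms.S_def)

lemma grad_lipschitz:
  assumes z: "z \<in> ms.Spos" "z' \<in> ms.Spos" and M: "0 \<le> M" and cl: "ms.close M z z'" and i: "i \<in> I"
  shows "2 * (conj_exp (by_block pw pv pu (blk i)) - 1) * (ln (grad z i) - ln (grad z' i))
      \<le> lam * M * by_block bw bv bu (blk i)"
proof -
  have sph: "sphere z" "sphere z'" using z S_iff by (auto simp: ms.Spos_def)
  have cl': "ms.close M z' z" using cl by (auto simp: ms.close_def abs_minus_commute)
  have mu: "0 \<le> M * bw" "0 \<le> M * bv" "0 \<le> M * bu" using M b_gt by auto
  note dom = close_dominated[OF z cl] close_dominated[OF z(2,1) cl']
  have pos: "0 < grad z i" "0 < grad z' i" using grad_pos[OF Spos_nonneg[OF z(1)] i] grad_pos[OF Spos_nonneg[OF z(2)] i] by auto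
  have q: "0 \<le> conj_exp p - 1" if "1 < p" for p :: real using that by (simp add: conj_exp_minus_1)
  have conclude: "2 * (conj_exp p - 1) * (ln (grad z i) - ln (grad z' i)) \<le> lam * M * b"
    if "grad z i \<le> exp L * grad z' i" "2 * (conj_exp p - 1) * L' \<le> lam * b" "L = M * L'" "1 < p" for L L' p b
  proof -
    have "ln (grad z i) \<le> ln (exp L * grad z' i)" using that pos by (intro ln_mono) auto
    then have "ln (grad z i) - ln (grad z' i) \<le> L" using pos by (simp add: ln_mult)
    then have "2 * (conj_exp p - 1) * (ln (grad z i) - ln (grad z' i)) \<le> 2 * (conj_exp p - 1) * L"
      using q[OF that(4)] by (intro mult_left_mono) auto
    also have "\<dots> = M * (2 * (conj_exp p - 1) * L')" using that(3) by simp
    also have "\<dots> \<le> M * (lam * b)" using that(2) M by (rule mult_left_mono)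
    finally show ?thesis by (simp add: mult_ac)
  qed
  show ?thesis
  proof (cases i)
    case (W r l)
    then have r: "r < K" "l < n2" using i by auto
    show ?thesis
      using conclude[OF grad_ratio_W[OF sph mu dom r, folded W] eigen_w _ p_gt(1)] W r
      by (simp add: algebra_simps)
  next
    case (V l m)
    then have r: "l < n2" "m < n1" using i by auto
    show ?thesis
      using conclude[OF grad_ratio_V[OF sph mu dom r, folded V] eigen_v _ p_gt(2)] V r
      by (simp add: algebra_simps)
  next
    case (U m s)
    then have r: "m < n1" "s < d" using i by auto
    show ?thesis
      using conclude[OF grad_ratio_U[OF sph mu dom r, folded U] eigen_u _ p_gt(3)] U r
      by (simp add: algebra_simps)
  qed
qed

sublocale asc: ascent I blk "by_block pw pv pu" "by_block \<rho>w \<rho>v \<rho>u" "by_block bw bv bu" F grad \<epsilon> lam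
proof unfold_locales
  show "\<exists>C. \<forall>s\<in>{1 / 2..1}. F z - F (z(j := s * z j)) \<le> C * (1 - s)" if "z \<in> ms.S" "j \<in> I" for z j
    using F_loss that S_iff by blast
  show "0 < grad z i" if "z \<in> ms.Spos" "i \<in> I" for z i
    using grad_pos[OF Spos_nonneg] that by blast
qed (use eps_gt lam_bounds continuous_on_F F_deriv F_gain grad_lipschitz in blast)+

section \<open>Transfer between parameter triples and flat functions\<close>

lemma S_plus_iff: "P \<in> S_plus K n2 n1 d pw pv pu \<rho>w \<rho>v \<rho>u \<longleftrightarrow> flat P \<in> ms.S"
proof -
  have all: "(\<forall>i. Q i) \<longleftrightarrow> (\<forall>i j. Q (W i j)) \<and> (\<forall>i j. Q (V i j)) \<and> (\<forall>i j. Q (U i j))" for Q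
    by (metis idx.exhaust)
  show ?thesis unfolding S_iff sphere_def S_plus_def all
    by (cases P) (auto simp: flat_def supported_def)
qed

lemma S_pp_iff: "P \<in> S_pp K n2 n1 d pw pv pu \<rho>w \<rho>v \<rho>u \<longleftrightarrow> flat P \<in> ms.Spos"
proof -
  have all: "(\<forall>i\<in>I. Q i) \<longleftrightarrow> (\<forall>i<K. \<forall>j<n2. Q (W i j)) \<and> (\<forall>i<n2. \<forall>j<n1. Q (V i j)) \<and> (\<forall>i<n1. \<forall>j<d. Q (U i j))" for Q
    by (auto simp: I_def)
  show ?thesis unfolding ms.Spos_def all S_plus_iff[symmetric] mem_Collect_eq S_pp_def
    by (cases P) (auto simp: flat_def)
qed

lemma deriv_F_coordinate:
  assumes "\<forall>i\<in>I. 0 < z i" "j \<in> I"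
  shows "deriv (\<lambda>t. F (z(j := t))) (z j) = grad z j"
proof (rule DERIV_imp_deriv)
  have "((\<lambda>t. F (z(j := t))) has_real_derivative (\<Sum>i\<in>I. grad (z(j := z j)) i * (if i = j then 1 else 0))) (at (z j))"
    using assms by (intro F_deriv) auto
  moreover have "(\<Sum>i\<in>I. grad z i * (if i = j then 1 else 0)) = (\<Sum>i\<in>{j}. grad z i * (if i = j then 1 else 0))"
    using finite_I assms by (intro sum.mono_neutral_right) auto
  ultimately show "((\<lambda>t. F (z(j := t))) has_real_derivative grad z j) (at (z j))" by simp
qed

abbreviation Objective :: "params \<Rightarrow> real" where
  "Objective \<equiv> Phi n K n2 n1 d \<alpha> \<beta> \<epsilon> X Y"

abbreviation G :: "params \<Rightarrow> params" where
  "G \<equiv> G_map K n2 n1 d pw pv pu \<rho>w \<rho>v \<rho>u Objective"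

lemma gradients:
  assumes pos: "\<forall>i\<in>I. 0 < flat P i"
  shows "i < K \<Longrightarrow> j < n2 \<Longrightarrow> grad_w Objective P i j = grad (flat P) (W i j)"
    and "i < n2 \<Longrightarrow> j < n1 \<Longrightarrow> grad_v Objective P i j = grad (flat P) (V i j)"
    and "i < n1 \<Longrightarrow> j < d \<Longrightarrow> grad_u Objective P i j = grad (flat P) (U i j)"
proof -
  obtain w v u where P: "P = (w, v, u)" by (cases P)
  have "F ((flat P)(W i j := t)) = Objective (w(i := (w i)(j := t)), v, u)" for t
    unfolding F_def P by (intro arg_cong[where f=Objective]) (auto simp: unflat_def flat_def fun_eq_iff)
  then show "i < K \<Longrightarrow> j < n2 \<Longrightarrow> grad_w Objective P i j = grad (flat P) (W i j)"
    using deriv_F_coordinate[OF pos, of "W i j"] by (simp add: grad_w_def P) (simp add: flat_def)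
  have "F ((flat P)(V i j := t)) = Objective (w, v(i := (v i)(j := t)), u)" for t
    unfolding F_def P by (intro arg_cong[where f=Objective]) (auto simp: unflat_def flat_def fun_eq_iff)
  then show "i < n2 \<Longrightarrow> j < n1 \<Longrightarrow> grad_v Objective P i j = grad (flat P) (V i j)"
    using deriv_F_coordinate[OF pos, of "V i j"] by (simp add: grad_v_def P) (simp add: flat_def)
  have "F ((flat P)(U i j := t)) = Objective (w, v, u(i := (u i)(j := t)))" for t
    unfolding F_def P by (intro arg_cong[where f=Objective]) (auto simp: unflat_def flat_def fun_eq_iff)
  then show "i < n1 \<Longrightarrow> j < d \<Longrightarrow> grad_u Objective P i j = grad (flat P) (U i j)"
    using deriv_F_coordinate[OF pos, of "U i j"] by (simp add: grad_u_def P) (simp add: flat_def)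
qed

text \<open>\<open>G\<close> is defined by \<open>deriv\<close>, which is known to agree with the
  closed form \<open>grad\<close> at positive parameters; iterates stay there by
  \<open>step_Spos\<close>.\<close>

lemma flat_G:
  assumes "flat P \<in> ms.Spos"
  shows "flat (G P) = asc.step (flat P)"
proof
  have pos: "\<forall>i\<in>I. 0 < flat P i" using assms by (simp add: ms.Spos_def)
  note gr = gradients[OF pos]
  have w: "pnorm pw {..<n2} (\<lambda>j. psi q (grad_w Objective P r j)) = pnorm pw {..<n2} (\<lambda>j. psi q (grad (flat P) (W r j)))"
    if "r < K" for q r using that by (intro pnorm_cong) (simp add: gr)
  have v: "mnorm pv n2 n1 (\<lambda>i j. psi q (grad_v Objective P i j)) = mnorm pv n2 n1 (\<lambda>i j. psi q (grad (flat P) (V i j)))"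
    for q unfolding mnorm_def by (intro pnorm_cong) (auto simp: gr)
  have u: "mnorm pu n1 d (\<lambda>i j. psi q (grad_u Objective P i j)) = mnorm pu n1 d (\<lambda>i j. psi q (grad (flat P) (U i j)))"
    for q unfolding mnorm_def by (intro pnorm_cong) (auto simp: gr)
  fix i show "flat (G P) i = asc.step (flat P) i"
    by (cases i) (auto simp: flat_tuple G_map_def Let_def asc.step_def w v u gr
        pnorm_block_W pnorm_block_V pnorm_block_U)
qed

lemma flat_G_funpow:
  assumes "flat P \<in> ms.Spos"
  shows "flat ((G ^^ k) P) = (asc.step ^^ k) (flat P) \<and> flat ((G ^^ k) P) \<in> ms.Spos"
proof (induction k)
  case 0 then show ?case using assms by simp
next
  case (Suc k)
  then have k: "flat ((G ^^ k) P) \<in> ms.Spos" by (rule conjunct2)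
  show ?case using Suc flat_G[OF k] asc.step_Spos[OF k] by simp
qed

lemma dist_inf_bounds:
  shows "0 \<le> dist_inf K n2 n1 d P Q"
    and "\<forall>i\<in>I. \<bar>flat P i - flat Q i\<bar> \<le> c \<Longrightarrow> dist_inf K n2 n1 d P Q \<le> c"
proof -
  obtain w v u w' v' u' where PQ: "P = (w, v, u)" "Q = (w', v', u')" by (cases P, cases Q)
  define D where "D = (\<lambda>(i, j). \<bar>w i j - w' i j\<bar>) ` ({..<K} \<times> {..<n2})
         \<union> (\<lambda>(i, j). \<bar>v i j - v' i j\<bar>) ` ({..<n2} \<times> {..<n1})
         \<union> (\<lambda>(i, j). \<bar>u i j - u' i j\<bar>) ` ({..<n1} \<times> {..<d})"
  have eq: "dist_inf K n2 n1 d P Q = Max D" by (simp add: dist_inf_def PQ D_def)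
  have fin: "finite D" by (simp add: D_def)
  \<comment> \<open>Position (0, 0) of v exists because both hidden layers are inhabited; it makes
    the maximum one over a nonempty set.\<close>
  have mem: "\<bar>v 0 0 - v' 0 0\<bar> \<in> D" using sizes by (force simp: D_def)
  show "0 \<le> dist_inf K n2 n1 d P Q" unfolding eq
    by (rule order_trans[OF abs_ge_zero Max_ge[OF fin mem]])
  assume c: "\<forall>i\<in>I. \<bar>flat P i - flat Q i\<bar> \<le> c"
  have "x \<le> c" if "x \<in> D" for x
    using that c[rule_format, of "W i j" for i j] c[rule_format, of "V i j" for i j] c[rule_format, of "U i j" for i j]
    by (auto simp: D_def flat_def PQ)
  then show "dist_inf K n2 n1 d P Q \<le> c" unfolding eq using fin mem by (subst Max_le_iff) auto
qed

theorem network_maximizer: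
  assumes "lam \<le> rA" "rA < 1"
  shows "\<exists>zs. zs \<in> S_pp K n2 n1 d pw pv pu \<rho>w \<rho>v \<rho>u
    \<and> (\<forall>z\<in>S_plus K n2 n1 d pw pv pu \<rho>w \<rho>v \<rho>u. Objective z \<le> Objective zs)
    \<and> (\<forall>z\<in>S_plus K n2 n1 d pw pv pu \<rho>w \<rho>v \<rho>u.
        (\<forall>z'\<in>S_plus K n2 n1 d pw pv pu \<rho>w \<rho>v \<rho>u. Objective z' \<le> Objective z) \<longrightarrow> z = zs)
    \<and> (\<forall>z0\<in>S_pp K n2 n1 d pw pv pu \<rho>w \<rho>v \<rho>u.
        (\<lambda>k. dist_inf K n2 n1 d ((G ^^ k) z0) zs) \<longlonglongrightarrow> 0
      \<and> (\<exists>R>0. \<forall>k. dist_inf K n2 n1 d ((G ^^ k) z0) zs \<le> R * rA ^ k))"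
proof -
  have obj: "Objective P = F (flat P)" for P by (simp add: F_def)
  obtain zs where zs: "zs \<in> ms.Spos" "\<forall>z\<in>ms.S. F z \<le> F zs"
      "\<forall>z\<in>ms.S. (\<forall>z'\<in>ms.S. F z' \<le> F z) \<longrightarrow> z = zs"
      "\<forall>z0\<in>ms.Spos. \<exists>R>0. \<forall>k. \<forall>i\<in>I. \<bar>(asc.step ^^ k) z0 i - zs i\<bar> \<le> R * lam ^ k"
    using asc.unique_maximizer_and_convergence by blast
  show ?thesis
  proof (intro exI[of _ "unflat zs"] conjI ballI impI)
    show "unflat zs \<in> S_pp K n2 n1 d pw pv pu \<rho>w \<rho>v \<rho>u" using zs(1) by (simp add: S_pp_iff)
    show "Objective z \<le> Objective (unflat zs)" if "z \<in> S_plus K n2 n1 d pw pv pu \<rho>w \<rho>v \<rho>u" for z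
      using that zs(2) by (simp add: S_plus_iff obj)
    show "z = unflat zs" if "z \<in> S_plus K n2 n1 d pw pv pu \<rho>w \<rho>v \<rho>u"
      "\<forall>z'\<in>S_plus K n2 n1 d pw pv pu \<rho>w \<rho>v \<rho>u. Objective z' \<le> Objective z" for z
    proof -
      have "\<forall>z'\<in>ms.S. F z' \<le> F (flat z)"
      proof
        fix z' assume "z' \<in> ms.S"
        then have "unflat z' \<in> S_plus K n2 n1 d pw pv pu \<rho>w \<rho>v \<rho>u" by (simp add: S_plus_iff)
        from that(2)[rule_format, OF this] show "F z' \<le> F (flat z)" by (simp add: obj)
      qed
      then have "flat z = zs" using zs(3) that(1) by (simp add: S_plus_iff)
      then show ?thesis by auto
    qed
    fix z0 assume "z0 \<in> S_pp K n2 n1 d pw pv pu \<rho>w \<rho>v \<rho>u"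
    then have z0: "flat z0 \<in> ms.Spos" by (simp add: S_pp_iff)
    then obtain R where R: "0 < R" "\<forall>k. \<forall>i\<in>I. \<bar>(asc.step ^^ k) (flat z0) i - zs i\<bar> \<le> R * lam ^ k"
      using zs(4) by blast
    have bound: "dist_inf K n2 n1 d ((G ^^ k) z0) (unflat zs) \<le> R * rA ^ k" for k
    proof -
      have "dist_inf K n2 n1 d ((G ^^ k) z0) (unflat zs) \<le> R * lam ^ k"
        using R(2) flat_G_funpow[OF z0] by (intro dist_inf_bounds(2)) simp
      also have "\<dots> \<le> R * rA ^ k" using R(1) lam_bounds assms by (intro mult_left_mono power_mono) auto
      finally show ?thesis .
    qed
    then show "\<exists>R>0. \<forall>k. dist_inf K n2 n1 d ((G ^^ k) z0) (unflat zs) \<le> R * rA ^ k" using R(1) by blast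
    have "(\<lambda>k. R * rA ^ k) \<longlonglongrightarrow> R * 0"
      using assms lam_bounds by (intro tendsto_mult tendsto_const LIMSEQ_power_zero) auto
    then have lim: "(\<lambda>k. R * rA ^ k) \<longlonglongrightarrow> 0" by simp
    show "(\<lambda>k. dist_inf K n2 n1 d ((G ^^ k) z0) (unflat zs)) \<longlonglongrightarrow> 0"
    proof (rule tendsto_sandwich[OF _ _ tendsto_const[of 0] lim])
      show "\<forall>\<^sub>F k in sequentially. 0 \<le> dist_inf K n2 n1 d ((G ^^ k) z0) (unflat zs)"
        by (intro always_eventually allI dist_inf_bounds(1))
      show "\<forall>\<^sub>F k in sequentially. dist_inf K n2 n1 d ((G ^^ k) z0) (unflat zs) \<le> R * rA ^ k"
        by (intro always_eventually allI bound)
    qed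
  qed
qed

end

section \<open>The eigenvector of A\<close>

text \<open>With \<open>A = 2 q \<otimes> r - diag\<close> up to the block structure, \<open>A b = x b\<close> is solved explicitly by
  \<open>b = 2 q / (x + 2 q)\<close> as soon as the decreasing secular function of \<open>x\<close> equals 1.\<close>
lemma secular_equation_solvable:
  fixes k q1 q2 q3 r1 r2 r3 :: real
  assumes q: "0 < q1" "0 < q2" "0 < q3" and k: "1 \<le> k" and r: "1 \<le> r1" "1 \<le> r2" "1 \<le> r3"
  obtains x where "0 \<le> x"
    "k * r1 * (2 * q1 / (x + 2 * k * q1)) + r2 * (2 * q2 / (x + 2 * q2)) + r3 * (2 * q3 / (x + 2 * q3)) = 1"
proof -
  define h where "h x = k * r1 * (2 * q1 / (x + 2 * k * q1)) + r2 * (2 * q2 / (x + 2 * q2)) + r3 * (2 * q3 / (x + 2 * q3))" for x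
  \<comment> \<open>At \<open>x = T\<close> every denominator is at least \<open>T\<close>, and the
    numerators add up to \<open>T\<close>, so the secular function is at most 1 there.\<close>
  define T where "T = k * r1 * (2 * q1) + r2 * (2 * q2) + r3 * (2 * q3)"
  have kq: "0 < k * q1" using k q by simp
  have T: "0 < T" using q k r by (auto simp: T_def intro!: add_pos_pos mult_pos_pos)
  have "h T \<le> k * r1 * (2 * q1 / T) + r2 * (2 * q2 / T) + r3 * (2 * q3 / T)"
    unfolding h_def using q k r T kq by (intro add_mono mult_left_mono divide_left_mono) (auto intro!: mult_pos_pos add_pos_pos)
  also have "\<dots> = T / T" unfolding T_def add_divide_distrib by simp
  finally have "h T \<le> 1" using T by simp
  \<comment> \<open>At 0 the quotients cancel and the value is \<open>r1 + r2 + r3\<close>.\<close>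
  moreover have "1 \<le> h 0" using q k r kq by (simp add: h_def)
  moreover have "continuous_on {0..T} h" unfolding h_def
    using q kq by (intro continuous_intros) (auto simp: add_nonneg_eq_0_iff)
  ultimately obtain x where "0 \<le> x" "h x = 1" using IVT2'[of h T 1 0] T by auto
  then show ?thesis using that by (simp add: h_def)
qed

text \<open>An explicit eigenvector puts \<open>x\<close> into the spectrum, so this comparison gets
  by without Perron-Frobenius theory; the positive entry \<open>b 0\<close> shows that the vector is
  nonzero.\<close>

lemma eigenvalue_le_spectral_radius:
  fixes a :: "nat \<Rightarrow> nat \<Rightarrow> real" and b :: "nat \<Rightarrow> real"
  assumes "0 < N" "0 \<le> x" "0 < b 0" "\<And>i. i < N \<Longrightarrow> (\<Sum>j<N. a i j * b j) = x * b i"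
  shows "x \<le> spectral_radius (mat N N (\<lambda>(i, j). complex_of_real (a i j)))"
proof -
  define A where "A = mat N N (\<lambda>(i, j). complex_of_real (a i j))"
  define v where "v = vec N (\<lambda>i. complex_of_real (b i))"
  have A: "A \<in> carrier_mat N N" by (simp add: A_def)
  have "v $ 0 \<noteq> 0" using assms by (simp add: v_def)
  then have "v \<noteq> 0\<^sub>v N" using assms(1) by auto
  moreover have "A *\<^sub>v v = complex_of_real x \<cdot>\<^sub>v v"
  proof (rule eq_vecI)
    fix i assume "i < dim_vec (complex_of_real x \<cdot>\<^sub>v v)"
    then have i: "i < N" by (simp add: v_def)
    have "(A *\<^sub>v v) $ i = (\<Sum>j<N. complex_of_real (a i j) * complex_of_real (b j))"
      using i by (simp add: A_def v_def scalar_prod_def atLeast0LessThan)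
    also have "\<dots> = complex_of_real (\<Sum>j<N. a i j * b j)" by simp
    also have "\<dots> = (complex_of_real x \<cdot>\<^sub>v v) $ i" using assms(4)[OF i] i by (simp add: v_def)
    finally show "(A *\<^sub>v v) $ i = (complex_of_real x \<cdot>\<^sub>v v) $ i" .
  qed (simp add: A_def v_def)
  ultimately have "eigenvector A v (complex_of_real x)" using A by (auto simp: eigenvector_def v_def)
  then have "complex_of_real x \<in> spectrum A" by (auto simp: spectrum_def eigenvalue_def)
  then have "norm (complex_of_real x) \<in> norm ` spectrum A" by (rule imageI)
  from spectral_radius_mem_max(2)[OF A assms(1) this] show ?thesis using assms(2) by (simp add: A_def)
qed

theorem mainTheorem13:
  fixes n K n1 n2 d :: nat
    and X :: "nat \<Rightarrow> nat \<Rightarrow> real" and Y :: "nat \<Rightarrow> nat"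
    and pw pv pu \<rho>w \<rho>v \<rho>u \<epsilon> :: real
    and \<alpha> \<beta> :: "nat \<Rightarrow> real"
  assumes "n \<ge> 1" and "n1 \<ge> 1" and "n2 \<ge> 1" and "d \<ge> 1"
    and X_nonneg: "\<forall>i<n. \<forall>s<d. X i s \<ge> 0"
    and Y_range: "\<forall>i<n. Y i < K"
    and "pw > 1" and "pv > 1" and "pu > 1"
    and "\<rho>w > 0" and "\<rho>v > 0" and "\<rho>u > 0" and "\<epsilon> > 0"
    and "\<forall>m<n1. \<alpha> m \<ge> 1" and "\<forall>l<n2. \<beta> l \<ge> 1"
    and rho_A: "let \<rho>x = Max ((\<lambda>i. pnorm (conj_exp pu) {..<d} (X i)) ` {..<n});
             \<theta> = \<rho>v * PsiFun n1 \<alpha> (conj_exp pv) pu (\<lambda>_. 1) (\<rho>u * \<rho>x);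
             Cw = \<rho>w * PsiFun n2 \<beta> (conj_exp pw) pv (\<lambda>_. 1) \<theta>;
             Cv = \<rho>w * PsiFun n2 \<beta> (conj_exp pw) pv \<beta> \<theta>;
             Cu = supnorm_vec n1 \<alpha> * Cv
         in spectral_radius (A_mat K pw pv pu Cw Cv Cu (supnorm_vec n1 \<alpha>) (supnorm_vec n2 \<beta>)) < 1"
  shows "let \<rho>x = Max ((\<lambda>i. pnorm (conj_exp pu) {..<d} (X i)) ` {..<n});
             \<theta> = \<rho>v * PsiFun n1 \<alpha> (conj_exp pv) pu (\<lambda>_. 1) (\<rho>u * \<rho>x);
             Cw = \<rho>w * PsiFun n2 \<beta> (conj_exp pw) pv (\<lambda>_. 1) \<theta>;
             Cv = \<rho>w * PsiFun n2 \<beta> (conj_exp pw) pv \<beta> \<theta>;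
             Cu = supnorm_vec n1 \<alpha> * Cv;
             rA = spectral_radius (A_mat K pw pv pu Cw Cv Cu (supnorm_vec n1 \<alpha>) (supnorm_vec n2 \<beta>));
             F = Phi n K n2 n1 d \<alpha> \<beta> \<epsilon> X Y;
             Sp = S_plus K n2 n1 d pw pv pu \<rho>w \<rho>v \<rho>u;
             Spp = S_pp K n2 n1 d pw pv pu \<rho>w \<rho>v \<rho>u;
             G = G_map K n2 n1 d pw pv pu \<rho>w \<rho>v \<rho>u F
         in \<exists>zs. zs \<in> Spp
              \<and> (\<forall>z\<in>Sp. F z \<le> F zs)
              \<and> (\<forall>z\<in>Sp. (\<forall>z'\<in>Sp. F z' \<le> F z) \<longrightarrow> z = zs)
              \<and> (\<forall>z0\<in>Spp.
                   (\<lambda>k. dist_inf K n2 n1 d ((G ^^ k) z0) zs) \<longlonglongrightarrow> 0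
                 \<and> (\<exists>R>0. \<forall>k. dist_inf K n2 n1 d ((G ^^ k) z0) zs \<le> R * rA ^ k))"
proof -
  interpret net: network n K n1 n2 d X Y pw pv pu \<rho>w \<rho>v \<rho>u \<epsilon> \<alpha> \<beta>
    by unfold_locales (use assms in auto)
  define na nb where "na = net.na" and "nb = net.nb"
  define rA where "rA = spectral_radius (A_mat K pw pv pu net.Cw net.Cv (na * net.Cv) na nb)"
  have rA: "rA < 1"
    using rho_A unfolding rA_def Let_def net.Cw_def net.Cv_def net.\<theta>_def na_def nb_def net.na_def net.nb_def .
  define q1 q2 q3 where "q1 = conj_exp pw - 1" and "q2 = conj_exp pv - 1" and "q3 = conj_exp pu - 1"
  have q: "0 < q1" "0 < q2" "0 < q3" using net.p_gt by (auto simp: q1_def q2_def q3_def conj_exp_minus_1)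
  \<comment> \<open>Up to the row factors \<open>2 * q\<close>, the columns of A are constant with
    values \<open>r1\<close>, \<open>r2\<close>, \<open>r3\<close>, lowered by 1 where row and
    column belong to the same matrix. For w this concerns any two of its \<open>K\<close> rows,
    which is why \<open>K\<close> enters the denominator of \<open>bw\<close>.\<close>
  define r1 r2 r3 where "r1 = 2 * net.Cw + 1" and "r2 = 2 * net.Cv + nb" and "r3 = 2 * (na * net.Cv) + na * nb"
  have ab: "1 \<le> na" "1 \<le> nb" using net.na_ge_1 net.nb_ge_1 by (auto simp: na_def nb_def)
  have "1 * 1 \<le> na * nb" using ab by (intro mult_mono) auto
  then have r: "1 \<le> r1" "1 \<le> r2" "1 \<le> r3"
    using net.Cw_nonneg net.Cv_nonneg ab by (auto simp: r1_def r2_def r3_def intro: add_increasing)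
  have K: "1 \<le> real K" using net.K_pos by simp
  obtain x where x: "0 \<le> x"
    "K * r1 * (2 * q1 / (x + 2 * real K * q1)) + r2 * (2 * q2 / (x + 2 * q2)) + r3 * (2 * q3 / (x + 2 * q3)) = 1"
    by (rule secular_equation_solvable[OF q K r])
  define bw bv bu where "bw = 2 * q1 / (x + 2 * real K * q1)" and "bv = 2 * q2 / (x + 2 * q2)"
    and "bu = 2 * q3 / (x + 2 * q3)"
  have "0 < K * q1" using K q by simp
  then have pos: "0 < x + 2 * real K * q1" "0 < x + 2 * q2" "0 < x + 2 * q3" using q x(1) by auto
  then have b: "0 < bw" "0 < bv" "0 < bu" using q by (auto simp: bw_def bv_def bu_def)
  have total: "K * r1 * bw + r2 * bv + r3 * bu = 1" using x(2) by (simp add: bw_def bv_def bu_def)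
  have "bw * (x + 2 * real K * q1) = 2 * q1" "bv * (x + 2 * q2) = 2 * q2" "bu * (x + 2 * q3) = 2 * q3"
    using pos by (simp_all add: bw_def bv_def bu_def)
  then have solved: "x * bw = 2 * q1 * (1 - K * bw)" "x * bv = 2 * q2 * (1 - bv)" "x * bu = 2 * q3 * (1 - bu)"
    by (simp_all add: algebra_simps)
  \<comment> \<open>With the weighted total normalized to 1, each row of A is left with 1 minus the
    part of its own matrix, which is what \<open>solved\<close> provides.\<close>
  have sums: "K * (r1 - 1) * bw + r2 * bv + r3 * bu = 1 - K * bw"
    "K * r1 * bw + (r2 - 1) * bv + r3 * bu = 1 - bv"
    "K * r1 * bw + r2 * bv + (r3 - 1) * bu = 1 - bu"
    using total by (simp_all add: algebra_simps)
  have eig: "2 * q1 * (K * (r1 - 1) * bw + r2 * bv + r3 * bu) = x * bw"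
    "2 * q2 * (K * r1 * bw + (r2 - 1) * bv + r3 * bu) = x * bv"
    "2 * q3 * (K * r1 * bw + r2 * bv + (r3 - 1) * bu) = x * bu"
    unfolding solved sums by (rule refl)+
  \<comment> \<open>All rows of w receive the same weight, so \<open>K + 2\<close> eigenvalue
    equations reduce to three.\<close>
  define bk where "bk k = (if k < K then bw else if k = K then bv else bu)" for k
  have "x \<le> rA" unfolding rA_def A_mat_def
  proof (rule eigenvalue_le_spectral_radius[where b=bk])
    show "0 < bk 0" using net.K_pos b by (simp add: bk_def)
    fix i assume "i < K + 2"
    have split: "(\<Sum>j<K + 2. \<phi> j) = (\<Sum>j<K. \<phi> j) + \<phi> K + \<phi> (Suc K)" for \<phi> :: "nat \<Rightarrow> real" by simp
    have W: "(\<Sum>j<K. A_entry K pw pv pu net.Cw net.Cv (na * net.Cv) na nb i j * bk j)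
        = K * (A_entry K pw pv pu net.Cw net.Cv (na * net.Cv) na nb i 0 * bw)"
      using net.K_pos by (simp add: A_entry_def bk_def Let_def)
    consider "i < K" | "i = K" | "i = Suc K" using \<open>i < K + 2\<close> by linarith
    then show "(\<Sum>j<K + 2. A_entry K pw pv pu net.Cw net.Cv (na * net.Cv) na nb i j * bk j) = x * bk i"
    proof cases
      case 1
      then have "x * bk i = 2 * q1 * (K * (r1 - 1) * bw + r2 * bv + r3 * bu)" using eig by (simp add: bk_def)
      then show ?thesis unfolding split W using 1 net.K_pos
        by (simp add: A_entry_def bk_def Let_def q1_def r1_def r2_def r3_def) (simp add: algebra_simps)
    next
      case 2
      then have "x * bk i = 2 * q2 * (K * r1 * bw + (r2 - 1) * bv + r3 * bu)" using eig by (simp add: bk_def)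
      then show ?thesis unfolding split W using 2 net.K_pos
        by (simp add: A_entry_def bk_def Let_def q2_def r1_def r2_def r3_def) (simp add: algebra_simps)
    next
      case 3
      then have "x * bk i = 2 * q3 * (K * r1 * bw + r2 * bv + (r3 - 1) * bu)" using eig by (simp add: bk_def)
      then show ?thesis unfolding split W using 3 net.K_pos
        by (simp add: A_entry_def bk_def Let_def q3_def r1_def r2_def r3_def) (simp add: algebra_simps)
    qed
  qed (use x in auto)
  \<comment> \<open>The rows of A count all \<open>K\<close> rows of w, the contraction estimates
    only one; \<open>1 \<le> K\<close> turns the equations into the required inequalities.\<close>
  have le: "r1 * bw \<le> K * r1 * bw" "(r1 - 1) * bw \<le> K * (r1 - 1) * bw"
    using K r b by (auto intro!: mult_right_mono mult_le_cancel_right1[THEN iffD2])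
  interpret network_contraction n K n1 n2 d X Y pw pv pu \<rho>w \<rho>v \<rho>u \<epsilon> \<alpha> \<beta> bw bv bu x
  proof unfold_locales
    show "2 * (conj_exp pw - 1) * (2 * net.Cw * bw + (2 * net.Cv + net.nb) * bv
        + (2 * (net.na * net.Cv) + net.na * net.nb) * bu) \<le> x * bw"
      unfolding eig(1)[symmetric] q1_def[symmetric] na_def[symmetric] nb_def[symmetric]
        r2_def[symmetric] r3_def[symmetric]
      using le(2) q(1) by (intro mult_left_mono) (auto simp: r1_def)
    show "2 * (conj_exp pv - 1) * ((2 * net.Cw + 1) * bw + (2 * net.Cv + net.nb - 1) * bv
        + (2 * (net.na * net.Cv) + net.na * net.nb) * bu) \<le> x * bv"
      unfolding eig(2)[symmetric] q2_def[symmetric] na_def[symmetric] nb_def[symmetric]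
        r1_def[symmetric] r2_def[symmetric] r3_def[symmetric]
      using le(1) q(2) by (intro mult_left_mono) auto
    show "2 * (conj_exp pu - 1) * ((2 * net.Cw + 1) * bw + (2 * net.Cv + net.nb) * bv
        + (2 * (net.na * net.Cv) + net.na * net.nb - 1) * bu) \<le> x * bu"
      unfolding eig(3)[symmetric] q3_def[symmetric] na_def[symmetric] nb_def[symmetric]
        r1_def[symmetric] r2_def[symmetric] r3_def[symmetric]
      using le(1) q(3) by (intro mult_left_mono) auto
  qed (use b x \<open>x \<le> rA\<close> rA in auto)
  show ?thesis
    using network_maximizer[OF \<open>x \<le> rA\<close> rA]
    unfolding rA_def Let_def net.Cw_def net.Cv_def net.\<theta>_def na_def nb_def net.na_def net.nb_def .
qed

end
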